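(* Let $n$ be a positive integer, let $\alpha,\beta\vdash n$ be partitions of $n$, and put $m=l(\beta)$. (i) If $\beta_m=1$, then $$\zeta^\alpha_\beta=\sum_{\substack{1\le i\le l(\alpha)\\ \alpha_i>\alpha_{i+1}}}\zeta^{\alpha-\varepsilon_i}_{\beta-\varepsilon_m}.$$ (ii) If $\beta_m\neq 1$, then $$\zeta^\alpha_\beta=(\beta_m-1)^{-1}\Bigg[\sum_{\substack{1\le i\le l(\alpha)\\ \alpha_i>\alpha_{i+1}}}(\alpha_i-i)\,\zeta^{\alpha-\varepsilon_i}_{\beta-\varepsilon_m}-\sum_{\substack{1\le j\le m-1\\ \beta_j<\beta_{j-1}}}\mu_j\beta_j\,\zeta^\alpha_{\beta+\varepsilon_j-\varepsilon_m}\Bigg],$$ where $\mu=(\mu_1,\mu_2,\dots)=\mu(\beta-\varepsilon_m)$ and $\beta_0:=\infty$.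
   Context: $\mathbf N=\{0,1,2,\dots\}$. For $l\in\mathbf N$, $\Gamma_l$ is the set of integer sequences $\gamma=(\gamma_1,\dots,\gamma_l,0,0,\dots)$ with $\gamma_i\in\mathbf Z$; $\Gamma=\bigcup_l\Gamma_l$, a group under componentwise addition; $\Gamma^+$ is the set of $\gamma\in\Gamma$ with all $\gamma_i\ge 0$. For $\gamma\in\Gamma$, the length $l(\gamma)$ is the least $l\in\mathbf N$ with $\gamma\in\Gamma_l$, and $|\gamma|=\sum_i\gamma_i$. The sequence $\varepsilon_i\in\Gamma$ has $1$ in position $i$ and zeros elsewhere. An element $\gamma\in\Gamma^+$ is a partition of $n$, written $\gamma\vdash n$, if $|\gamma|=n$ and $\gamma_i\ge\gamma_{i+1}$ for all $i\geq 1$. $S_n$ is the symmetric group on $\{1,\dots,n\}$ ($S_0$ is trivial). For $\beta\in\Gamma^+$ with $|\beta|=n$ (not necessarily nonincreasing), $\sigma_\beta\in S_n$ is the product over $j\ge 1$ of the disjoint cycles $(s_{j1},s_{j2},\dots,s_{j\beta_j})$, where $s_{ji}=i+\sum_{k=1}^{j-1}\beta_k$ (the factor is the identity if $\beta_j=0$). For $\alpha\vdash n$, $\zeta^\alpha$ denotes the irreducible (complex) character of $S_n$ corresponding to $\alpha$ in the standard way: the character of the Specht module of $\alpha$, equivalently the unique common irreducible constituent of the character induced to $S_n$ from the trivial character of the Young subgroup $S_\alpha$ and the character induced to $S_n$ from the sign character of the Young subgroup $S_{\alpha'}$, with $\alpha'$ the conjugate partition (so $\zeta^{(n)}$ is trivial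 and $\zeta^{(1^n)}$ is the sign character). For $\beta\in\Gamma^+$ with $|\beta|=n$, $\zeta^\alpha_\beta:=\zeta^\alpha(\sigma_\beta)$. For $n=0$, the sole value is $\zeta^0_0=1$. For $\gamma\in\Gamma$ with $m=l(\gamma)$, $\mu(\gamma)=(\mu_1,\dots,\mu_m)$ where $\mu_j=|\{1\le k\le m\mid\gamma_k=\gamma_j\}|$ for $1\le j\le m$. *)

theory Defs
  imports
    Complex_Main
    "HOL-Library.Function_Algebras"
    "HOL-Combinatorics.Permutations"
    "HOL-Combinatorics.Cycles"
begin

section \<open>Integer sequences and partitions\<close>

text \<open>
  Sequences are indexed from 1. The unused value at index 0 is fixed to be 0, so that equality of
  functions is equality of sequences. Addition and subtraction are those of
  \<^theory>\<open>HOL-Library.Function_Algebras\<close>.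
\<close>

definition Gam_upto :: "nat \<Rightarrow> (nat \<Rightarrow> int) set" where
  "Gam_upto l = {\<gamma>. \<forall>i. i = 0 \<or> i > l \<longrightarrow> \<gamma> i = 0}"

definition Gam :: "(nat \<Rightarrow> int) set" where
  "Gam = (\<Union>l. Gam_upto l)"

definition Gam_nonneg :: "(nat \<Rightarrow> int) set" where
  "Gam_nonneg = {\<gamma> \<in> Gam. \<forall>i\<ge>1. \<gamma> i \<ge> 0}"

definition len :: "(nat \<Rightarrow> int) \<Rightarrow> nat" where
  "len \<gamma> = (LEAST l. \<gamma> \<in> Gam_upto l)"

definition weight :: "(nat \<Rightarrow> int) \<Rightarrow> int" where
  "weight \<gamma> = (\<Sum>i = 1..len \<gamma>. \<gamma> i)"

definition eps :: "nat \<Rightarrow> nat \<Rightarrow> int" where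
  "eps i = (\<lambda>k. if k = i then 1 else 0)"

definition partition_of :: "(nat \<Rightarrow> int) \<Rightarrow> nat \<Rightarrow> bool" where
  "partition_of \<gamma> n \<longleftrightarrow> \<gamma> \<in> Gam_nonneg \<and> weight \<gamma> = int n \<and> (\<forall>i\<ge>1. \<gamma> i \<ge> \<gamma> (i + 1))"

definition multiplicity_in :: "(nat \<Rightarrow> int) \<Rightarrow> nat \<Rightarrow> nat" where
  "multiplicity_in \<gamma> j = card {k. 1 \<le> k \<and> k \<le> len \<gamma> \<and> \<gamma> k = \<gamma> j}"


section \<open>The permutation of cycle type \<open>\<beta>\<close>\<close>

definition cycle_entry :: "(nat \<Rightarrow> int) \<Rightarrow> nat \<Rightarrow> nat \<Rightarrow> nat" where
  "cycle_entry \<beta> j i = i + (\<Sum>k = 1..<j. nat (\<beta> k))"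

text \<open>
  The factors are disjoint cycles, so the order of composition is immaterial; those with
  \<open>j > len \<beta>\<close> are the identity.
\<close>

definition cycle_perm :: "(nat \<Rightarrow> int) \<Rightarrow> nat \<Rightarrow> nat" where
  "cycle_perm \<beta> =
     foldr (\<lambda>j \<pi>. cycle_of_list (map (cycle_entry \<beta> j) [1..<Suc (nat (\<beta> j))]) \<circ> \<pi>)
       [1..<Suc (len \<beta>)] id"


section \<open>Complex-valued functions as a vector space\<close>

definition fscale :: "complex \<Rightarrow> ('a \<Rightarrow> complex) \<Rightarrow> 'a \<Rightarrow> complex" where
  "fscale c f = (\<lambda>x. c * f x)"

interpretation cfun: vector_space "fscale :: complex \<Rightarrow> ('a \<Rightarrow> complex) \<Rightarrow> 'a \<Rightarrow> complex"
  by unfold_locales (auto simp: fscale_def fun_eq_iff algebra_simps)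

text \<open>
  The trace of an endomorphism \<open>f\<close> of the finite-dimensional subspace \<open>V\<close>: the sum of its diagonal
  coefficients with respect to some basis of \<open>V\<close> (the value does not depend on the basis).
\<close>

definition trace_on :: "('a \<Rightarrow> complex) set \<Rightarrow> (('a \<Rightarrow> complex) \<Rightarrow> 'a \<Rightarrow> complex) \<Rightarrow> complex" where
  "trace_on V f =
     (let B = (SOME B. cfun.independent B \<and> cfun.span B = V)
      in \<Sum>b\<in>B. cfun.representation B (f b) b)"


section \<open>Specht modules and their characters\<close>

definition diagram :: "(nat \<Rightarrow> int) \<Rightarrow> (nat \<times> nat) set" where
  "diagram \<alpha> = {(i, j). 1 \<le> i \<and> 1 \<le> j \<and> int j \<le> \<alpha> i}"

definition tableau :: "(nat \<Rightarrow> int) \<Rightarrow> (nat \<times> nat \<Rightarrow> nat) \<Rightarrow> bool" where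
  "tableau \<alpha> t \<longleftrightarrow> bij_betw t (diagram \<alpha>) {1..nat (weight \<alpha>)}"

definition row_set :: "(nat \<Rightarrow> int) \<Rightarrow> (nat \<times> nat \<Rightarrow> nat) \<Rightarrow> nat \<Rightarrow> nat set" where
  "row_set \<alpha> t i = {t (i, j) | j. (i, j) \<in> diagram \<alpha>}"

definition col_set :: "(nat \<Rightarrow> int) \<Rightarrow> (nat \<times> nat \<Rightarrow> nat) \<Rightarrow> nat \<Rightarrow> nat set" where
  "col_set \<alpha> t j = {t (i, j) | i. (i, j) \<in> diagram \<alpha>}"

definition column_stabilizer :: "(nat \<Rightarrow> int) \<Rightarrow> (nat \<times> nat \<Rightarrow> nat) \<Rightarrow> (nat \<Rightarrow> nat) set" where
  "column_stabilizer \<alpha> t =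
     {\<pi>. \<pi> permutes {1..nat (weight \<alpha>)} \<and> (\<forall>j\<ge>1. \<pi> ` col_set \<alpha> t j = col_set \<alpha> t j)}"

text \<open>
  The tabloid of \<open>t\<close> is represented by its sequence of row sets \<open>row_set \<alpha> t :: nat \<Rightarrow> nat set\<close>, and
  the permutation module is the space of complex functions of tabloids. The polytabloid of \<open>t\<close> is
  the sum of \<open>sgn \<pi> \<cdot> {\<pi> t}\<close> over the column stabilizer.
\<close>

definition tabloid_vec :: "(nat \<Rightarrow> nat set) \<Rightarrow> (nat \<Rightarrow> nat set) \<Rightarrow> complex" where
  "tabloid_vec T = (\<lambda>U. if U = T then 1 else 0)"

definition polytabloid ::
  "(nat \<Rightarrow> int) \<Rightarrow> (nat \<times> nat \<Rightarrow> nat) \<Rightarrow> (nat \<Rightarrow> nat set) \<Rightarrow> complex" where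
  "polytabloid \<alpha> t =
     (\<Sum>\<pi>\<in>column_stabilizer \<alpha> t. fscale (of_int (sign \<pi>)) (tabloid_vec (row_set \<alpha> (\<pi> \<circ> t))))"

definition specht :: "(nat \<Rightarrow> int) \<Rightarrow> ((nat \<Rightarrow> nat set) \<Rightarrow> complex) set" where
  "specht \<alpha> = cfun.span {polytabloid \<alpha> t | t. tableau \<alpha> t}"

text \<open>
  The linear action of \<open>\<sigma>\<close> that maps the basis vector of a tabloid \<open>T\<close> to that of \<open>\<sigma> T\<close>; as an
  operation on functions of tabloids this is composition with the inverse of \<open>\<sigma>\<close>.
\<close>

definition perm_action ::
  "(nat \<Rightarrow> nat) \<Rightarrow> ((nat \<Rightarrow> nat set) \<Rightarrow> complex) \<Rightarrow> (nat \<Rightarrow> nat set) \<Rightarrow> complex" where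
  "perm_action \<sigma> f = (\<lambda>T. f (\<lambda>i. inv \<sigma> ` T i))"

definition specht_character :: "(nat \<Rightarrow> int) \<Rightarrow> (nat \<Rightarrow> nat) \<Rightarrow> complex" where
  "specht_character \<alpha> \<sigma> = trace_on (specht \<alpha>) (perm_action \<sigma>)"

definition zeta :: "(nat \<Rightarrow> int) \<Rightarrow> (nat \<Rightarrow> int) \<Rightarrow> complex" where
  "zeta \<alpha> \<beta> = specht_character \<alpha> (cycle_perm \<beta>)"

end

theory Submission
  imports Defs "HOL-Library.Multiset"
begin

text \<open>
  The point is to compute one trace in two ways. Put \<open>\<gamma> = \<beta> - eps m\<close> and let \<open>\<tau>\<close> be its permutation
  of \<open>{1..n - 1}\<close>. Let \<open>X\<close> be the Jucys-Murphy element, the sum of the transpositions \<open>(k n)\<close> over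
  \<open>k < n\<close>, which commutes with \<open>\<tau>\<close>; consider \<open>\<tau> X\<close> on the Specht module \<open>S\<^sup>\<alpha>\<close>.

  On the one hand, \<open>\<tau> \<circ> (k n)\<close> is \<open>\<tau>\<close> with the point \<open>n\<close> inserted into the cycle of \<open>k\<close>, so it is
  conjugate to the permutation of \<open>\<gamma> + eps j\<close>, where \<open>j\<close> is the index of that cycle; each \<open>j\<close> arises
  from \<open>\<gamma> j\<close> values of \<open>k\<close> (\<open>sum_class_function_merge_point\<close>). The index \<open>j = m\<close> gives
  \<open>(\<beta> m - 1) \<cdot> zeta \<alpha> \<beta>\<close>; the other indices, collected by equal values of \<open>\<beta> j\<close>
  (\<open>sum_over_run_starts\<close>), give the sum that is subtracted in the formula.

  On the other hand, \<open>S\<^sup>\<alpha>\<close> restricted to permutations that fix \<open>n\<close> has a filtration whose nonzero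
  quotients are the \<open>S\<^bsup>\<alpha> - eps s\<^esup>\<close> for the removable corners \<open>s\<close>, and \<open>X\<close> acts on such a quotient as the content
  \<open>\<alpha> s - s\<close> of the removed box. Thus the trace of \<open>\<tau>\<close> is the sum of the values
  \<open>zeta (\<alpha> - eps s) \<gamma>\<close> (\<open>branching_rule\<close>), and the trace of \<open>\<tau> X\<close> is the same sum weighted by
  contents (\<open>jucys_murphy_trace\<close>). If \<open>\<beta> m = 1\<close> then \<open>\<tau>\<close> already is the permutation of \<open>\<beta>\<close>, and the
  branching rule is the claim; otherwise the two values of the trace of \<open>\<tau> X\<close> are compared.

  The filtration has two descriptions. The space \<open>row_filtration s\<close> consists of the vectors
  supported on tabloids in which \<open>n\<close> lies in one of the rows up to \<open>s\<close>; deleting \<open>n\<close> from row \<open>s\<close> is a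
  linear map with kernel \<open>row_filtration (s - 1)\<close>. The space \<open>corner_span s\<close> is spanned by the
  polytabloids of tableaux with \<open>n\<close> in a corner of one of the rows up to \<open>s\<close>; if row \<open>s\<close> ends
  in a corner, deleting \<open>n\<close> from this row maps it onto \<open>S\<^bsup>\<alpha> - eps s\<^esup>\<close>. On both, \<open>X\<close> acts as the content of \<open>s\<close> modulo the previous space: for the first
  because of linear equations that hold throughout \<open>S\<^sup>\<alpha>\<close> (\<open>specht_kernel_relation\<close>), for the second
  because of the Garnir relations that exchange a single entry with a whole column
  (\<open>garnir_one_cell\<close>). Since the contents of distinct rows differ and both filtrations end with
  \<open>S\<^sup>\<alpha>\<close>, they coincide (\<open>row_filtration_eq_corner_span\<close>). This identifies the quotients.
\<close>

section \<open>Traces on finite-dimensional spaces of functions\<close>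

abbreviation lin :: "(('a \<Rightarrow> complex) \<Rightarrow> ('b \<Rightarrow> complex)) \<Rightarrow> bool" where
  "lin \<equiv> Vector_Spaces.linear fscale fscale"

lemma linI:
  assumes "\<And>x y. f (x + y) = f x + f y" "\<And>c x. f (fscale c x) = fscale c (f x)"
  shows "lin f"
  using assms by unfold_locales (auto simp: fscale_def fun_eq_iff algebra_simps)

lemma lin_add: "lin f \<Longrightarrow> f (x + y) = f x + f y"
  and lin_scale: "lin f \<Longrightarrow> f (fscale c x) = fscale c (f x)"
  by (simp_all add: Vector_Spaces.linear_def module_hom_def module_hom_axioms_def)

text \<open>
  The chosen basis of the definition is not accessible, so traces are computed through an arbitrary
  finite basis. Expanding \<open>f b\<close> in two bases writes both diagonal sums as the same double sum, which
  is the identity \<open>tr (P Q) = tr (Q P)\<close> for the matrix of the base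
  change and the matrix of \<open>f\<close> between the two bases.
\<close>

lemma trace_on_eq_basis_sum:
  fixes V :: "('a \<Rightarrow> complex) set"
  assumes f: "lin f" and fV: "f ` V \<subseteq> V"
    and B: "cfun.independent B" "cfun.span B = V" "finite B"
  shows "trace_on V f = (\<Sum>b\<in>B. cfun.representation B (f b) b)"
proof -
  interpret f: Vector_Spaces.linear fscale fscale f by fact
  define C where "C = (SOME B. cfun.independent B \<and> cfun.span B = V)"
  have C: "cfun.independent C" "cfun.span C = V"
    using someI[of "\<lambda>B. cfun.independent B \<and> cfun.span B = V" B] B unfolding C_def by auto
  have finC: "finite C"
    using cfun.independent_span_bound[of B C] B C cfun.span_superset[of C] by auto
  have BV: "b \<in> V" if "b \<in> B" for b using B that cfun.span_base by blast
  have CV: "b \<in> V" if "b \<in> C" for b using C that cfun.span_base by blast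
  have fBV: "f b \<in> V" if "b \<in> V" for b using fV that by blast
  let ?RB = "cfun.representation B" and ?RC = "cfun.representation C"
  have expC: "(\<Sum>c\<in>C. fscale (?RC v c) c) = v" if "v \<in> V" for v
    by (rule cfun.sum_representation_eq) (use C finC that in auto)
  have expB: "(\<Sum>c\<in>B. fscale (?RB v c) c) = v" if "v \<in> V" for v
    by (rule cfun.sum_representation_eq) (use B that in auto)
  have 1: "?RB (f b) b = (\<Sum>c\<in>C. ?RC b c * ?RB (f c) b)" if "b \<in> B" for b
  proof -
    have "?RB (f b) b = ?RB (f (\<Sum>c\<in>C. fscale (?RC b c) c)) b"
      using expC BV that by simp
    also have "\<dots> = ?RB (\<Sum>c\<in>C. fscale (?RC b c) (f c)) b"
      by (simp add: f.sum f.scale)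
    also have "\<dots> = (\<Sum>c\<in>C. ?RC b c * ?RB (f c) b)"
      using B CV fBV
      by (subst cfun.representation_sum) (auto intro!: cfun.span_scale simp: cfun.representation_scale)
    finally show ?thesis .
  qed
  have 2: "?RC (f c) c = (\<Sum>b\<in>B. ?RC b c * ?RB (f c) b)" if "c \<in> C" for c
  proof -
    have "?RC (f c) c = ?RC (\<Sum>b\<in>B. fscale (?RB (f c) b) b) c"
      using expB[of "f c"] CV fBV that by simp
    also have "\<dots> = (\<Sum>b\<in>B. ?RB (f c) b * ?RC b c)"
      using C BV
      by (subst cfun.representation_sum) (auto intro!: cfun.span_scale simp: cfun.representation_scale)
    finally show ?thesis by (simp add: mult.commute)
  qed
  have "trace_on V f = (\<Sum>c\<in>C. ?RC (f c) c)"
    unfolding trace_on_def C_def Let_def ..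
  also have "\<dots> = (\<Sum>c\<in>C. \<Sum>b\<in>B. ?RC b c * ?RB (f c) b)" using 2 by simp
  also have "\<dots> = (\<Sum>b\<in>B. \<Sum>c\<in>C. ?RC b c * ?RB (f c) b)" by (rule sum.swap)
  also have "\<dots> = (\<Sum>b\<in>B. ?RB (f b) b)" using 1 by simp
  finally show ?thesis .
qed

text \<open>
  A subspace need not be given as a span of finitely many vectors; it is enough that it lies in one.
\<close>

lemma subspace_basis:
  fixes V :: "('a \<Rightarrow> complex) set"
  assumes "cfun.subspace V" "finite S" "V \<subseteq> cfun.span S"
    and "A \<subseteq> V" "cfun.independent A"
  obtains B where "A \<subseteq> B" "cfun.independent B" "cfun.span B = V" "finite B"
proof -
  obtain B where B: "A \<subseteq> B" "B \<subseteq> V" "cfun.independent B" "V \<subseteq> cfun.span B"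
    using cfun.maximal_independent_subset_extend[OF assms(4,5)] by metis
  have "finite B" using cfun.independent_span_bound[OF assms(2) B(3)] B(2) assms(3) by blast
  moreover have "cfun.span B = V" using B assms(1) by (meson cfun.span_minimal subset_antisym)
  ultimately show thesis using B that by blast
qed

lemma trace_on_sum:
  fixes V :: "('a \<Rightarrow> complex) set" and F :: "'i \<Rightarrow> ('a \<Rightarrow> complex) \<Rightarrow> 'a \<Rightarrow> complex"
  assumes V: "cfun.subspace V" "finite S" "V \<subseteq> cfun.span S"
    and F: "\<And>i. i \<in> I \<Longrightarrow> lin (F i)" "\<And>i. i \<in> I \<Longrightarrow> F i ` V \<subseteq> V"
  shows "trace_on V (\<lambda>v. \<Sum>i\<in>I. F i v) = (\<Sum>i\<in>I. trace_on V (F i))"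
proof -
  obtain B where B: "cfun.independent B" "cfun.span B = V" "finite B"
    using subspace_basis[OF V, of "{}"] cfun.independent_empty by auto
  have BV: "b \<in> V" if "b \<in> B" for b using B that cfun.span_base by blast
  have lin: "lin (\<lambda>v. \<Sum>i\<in>I. F i v)"
  proof (rule linI)
    fix x y c
    show "(\<Sum>i\<in>I. F i (x + y)) = (\<Sum>i\<in>I. F i x) + (\<Sum>i\<in>I. F i y)"
      unfolding sum.distrib[symmetric] using F(1) by (intro sum.cong refl lin_add)
    show "(\<Sum>i\<in>I. F i (fscale c x)) = fscale c (\<Sum>i\<in>I. F i x)"
      using F(1) by (simp add: cfun.scale_sum_right lin_scale)
  qed
  have sub: "(\<lambda>v. \<Sum>i\<in>I. F i v) ` V \<subseteq> V"
    using V(1) F(2) by (auto intro!: cfun.subspace_sum)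
  have FV: "F i b \<in> cfun.span B" if "i \<in> I" "b \<in> B" for i b using F(2)[OF that(1)] BV that B(2) by blast
  have "trace_on V (\<lambda>v. \<Sum>i\<in>I. F i v) = (\<Sum>b\<in>B. \<Sum>i\<in>I. cfun.representation B (F i b) b)"
    using FV unfolding trace_on_eq_basis_sum[OF lin sub B]
    by (intro sum.cong refl, subst cfun.representation_sum[OF B(1)]) auto
  also have "\<dots> = (\<Sum>i\<in>I. \<Sum>b\<in>B. cfun.representation B (F i b) b)" by (rule sum.swap)
  also have "\<dots> = (\<Sum>i\<in>I. trace_on V (F i))"
    using F B by (intro sum.cong refl) (simp add: trace_on_eq_basis_sum)
  finally show ?thesis .
qed

lemma trace_on_scale:
  assumes V: "cfun.subspace V" "finite S" "V \<subseteq> cfun.span S" 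
    and f: "lin f" "f ` V \<subseteq> V"
  shows "trace_on V (\<lambda>v. fscale c (f v)) = c * trace_on V f"
proof -
  obtain B where B: "cfun.independent B" "cfun.span B = V" "finite B"
    using subspace_basis[OF V, of "{}"] cfun.independent_empty by auto
  have BV: "b \<in> V" if "b \<in> B" for b using B that cfun.span_base by blast
  have lin: "lin (\<lambda>v. fscale c (f v))"
    by (rule linI) (simp_all add: lin_add[OF f(1)] lin_scale[OF f(1)] cfun.scale_right_distrib mult.commute)
  have sub: "(\<lambda>v. fscale c (f v)) ` V \<subseteq> V"
    using V(1) f(2) by (auto intro!: cfun.subspace_scale)
  show ?thesis using f B BV unfolding trace_on_eq_basis_sum[OF lin sub B] trace_on_eq_basis_sum[OF f B]
    by (simp add: sum_distrib_left, intro sum.cong refl, subst cfun.representation_scale) auto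
qed

lemma trace_on_zero_space: "trace_on {0} f = 0"
proof -
  let ?P = "\<lambda>B :: ('a \<Rightarrow> complex) set. cfun.independent B \<and> cfun.span B = {0}"
  have "?P {}" by (simp add: cfun.independent_empty cfun.span_empty)
  then have "?P (Eps ?P)" by (rule someI)
  then have "Eps ?P = {}"
    using cfun.span_superset[of "Eps ?P"] cfun.dependent_zero[of "Eps ?P"] by auto
  then show ?thesis by (simp add: trace_on_def)
qed

text \<open>
  Additivity of the trace along \<open>0 \<rightarrow> K \<rightarrow> V \<rightarrow> V' \<rightarrow> 0\<close>. A basis of \<open>K\<close> is extended to one of \<open>V\<close>; the
  images of the added vectors form a basis of \<open>V'\<close>, so the matrix of \<open>f\<close> is block triangular with
  the matrices of \<open>f\<close> on \<open>K\<close> and of \<open>g\<close> on \<open>V'\<close> as its diagonal blocks.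
\<close>

lemma trace_on_exact_sequence:
  fixes V :: "('a \<Rightarrow> complex) set" and \<theta> :: "('a \<Rightarrow> complex) \<Rightarrow> ('b \<Rightarrow> complex)"
  assumes V: "cfun.subspace V" "finite S" "V \<subseteq> cfun.span S"
    and f: "lin f" "f ` V \<subseteq> V" and g: "lin g" and \<theta>: "lin \<theta>" "\<theta> ` V = V'"
    and K: "K = {v \<in> V. \<theta> v = 0}"
    and comm: "\<And>v. v \<in> V \<Longrightarrow> \<theta> (f v) = g (\<theta> v)"
  shows "trace_on V f = trace_on K f + trace_on V' g"
proof -
  interpret f: Vector_Spaces.linear fscale fscale f by fact
  interpret g: Vector_Spaces.linear fscale fscale g by fact
  interpret t: Vector_Spaces.linear fscale fscale \<theta> by fact
  have Ksub: "cfun.subspace K" unfolding K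
    using V(1) by (auto simp: cfun.subspace_def t.add t.scale t.zero)
  have KV: "K \<subseteq> V" using K by auto
  have fK: "f ` K \<subseteq> K" using f(2) comm g.zero unfolding K by auto
  obtain A where A: "cfun.independent A" "cfun.span A = K" "finite A"
    using subspace_basis[OF Ksub V(2), of "{}"] V(3) KV cfun.independent_empty by auto
  have AK: "A \<subseteq> K" using A cfun.span_superset by blast
  obtain B where B: "A \<subseteq> B" "cfun.independent B" "cfun.span B = V" "finite B"
    using subspace_basis[OF V, of A] A(1) AK KV by blast
  have BV: "b \<in> V" if "b \<in> B" for b using B that cfun.span_base by blast
  define D where "D = B - A"
  have DB: "D \<subseteq> B" by (auto simp: D_def)
  have finD: "finite D" using B by (simp add: D_def)
  have zA: "\<theta> a = 0" if "a \<in> A" for a using AK that K by auto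
  let ?RB = "cfun.representation B"
  have expB: "(\<Sum>c\<in>B. fscale (?RB v c) c) = v" if "v \<in> V" for v
    by (rule cfun.sum_representation_eq) (use B that in auto)
  have t_exp: "\<theta> v = (\<Sum>b\<in>D. fscale (?RB v b) (\<theta> b))" if "v \<in> V" for v
  proof -
    have "\<theta> v = (\<Sum>b\<in>B. fscale (?RB v b) (\<theta> b))"
      using expB[OF that] by (metis (no_types, lifting) sum.cong t.scale t.sum)
    also have "\<dots> = (\<Sum>b\<in>D. fscale (?RB v b) (\<theta> b))"
      using B zA by (intro sum.mono_neutral_right) (auto simp: D_def)
    finally show ?thesis .
  qed
  \<comment> \<open>The images of the added basis vectors are independent: a relation between them lifts to a vector of
    \<open>K\<close>, whose expansion involves \<open>A\<close> only.\<close>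
  have key: "\<forall>b\<in>D. u b = 0" if "(\<Sum>b\<in>D. fscale (u b) (\<theta> b)) = 0" for u
  proof -
    let ?v = "\<Sum>b\<in>D. fscale (u b) b"
    have "?v \<in> V" using BV DB V(1) by (intro cfun.subspace_sum cfun.subspace_scale) auto
    moreover have "\<theta> ?v = 0" using that by (simp add: t.sum t.scale)
    ultimately have vK: "?v \<in> K" using K by auto
    show ?thesis
    proof
      fix b assume b: "b \<in> D"
      have "?RB ?v = cfun.representation A ?v"
        using cfun.representation_extend[OF B(2) _ B(1)] vK A(2) by simp
      then have "?RB ?v b = 0"
        using cfun.representation_ne_zero[of A ?v b] b by (auto simp: D_def)
      moreover have "?RB ?v b = (\<Sum>d\<in>D. u d * (if b = d then 1 else 0))"
        using B DB finD
        by (subst cfun.representation_sum)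
           (auto simp: cfun.representation_scale cfun.representation_basis cfun.span_base subset_iff
             intro!: cfun.span_scale sum.cong)
      ultimately show "u b = 0" using b finD by (simp add: if_distrib cong: if_cong)
    qed
  qed
  have inj: "inj_on \<theta> D"
  proof
    fix x y assume xy: "x \<in> D" "y \<in> D" "\<theta> x = \<theta> y"
    show "x = y"
    proof (rule ccontr)
      assume ne: "x \<noteq> y"
      let ?u = "\<lambda>b. if b = x then 1 else if b = y then -1 else (0::complex)"
      have "(\<Sum>b\<in>D. fscale (?u b) (\<theta> b)) = (\<Sum>b\<in>{x,y}. fscale (?u b) (\<theta> b))"
        using xy finD by (intro sum.mono_neutral_right) (auto simp: fscale_def)
      also have "\<dots> = \<theta> x - \<theta> y" using ne by simp
      also have "\<dots> = 0" using xy by simp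
      finally show False using key[of ?u] xy by auto
    qed
  qed
  let ?E = "\<theta> ` D"
  have indE: "cfun.independent ?E"
  proof
    assume "cfun.dependent ?E"
    then obtain u v where u: "(\<Sum>e\<in>?E. fscale (u e) e) = 0" "v \<in> ?E" "u v \<noteq> 0"
      using finD by (auto simp: cfun.dependent_finite)
    from u(1) have "(\<Sum>b\<in>D. fscale (u (\<theta> b)) (\<theta> b)) = 0"
      by (simp add: sum.reindex[OF inj])
    from key[OF this] u show False by auto
  qed
  have spanE: "cfun.span ?E = V'"
  proof -
    have "cfun.span (\<theta> ` B) = V'" using t.span_image[of B] B(3) \<theta>(2) by simp
    moreover have "\<theta> ` B \<subseteq> insert 0 ?E" using zA by (auto simp: D_def)
    then have "cfun.span (\<theta> ` B) \<subseteq> cfun.span ?E"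
      by (metis cfun.span_insert_0 cfun.span_mono)
    moreover have "cfun.span ?E \<subseteq> cfun.span (\<theta> ` B)" using DB by (intro cfun.span_mono) auto
    ultimately show ?thesis by auto
  qed
  have gV: "g ` V' \<subseteq> V'" using comm f(2) \<theta>(2) by (auto) (metis image_eqI image_subset_iff)
  have repE: "cfun.representation ?E (g (\<theta> b)) (\<theta> b) = ?RB (f b) b" if "b \<in> D" for b
  proof -
    have fb: "f b \<in> V" using that DB BV f(2) by auto
    have "g (\<theta> b) = (\<Sum>d\<in>D. fscale (?RB (f b) d) (\<theta> d))"
      using comm[of b] t_exp[OF fb] that BV DB by auto
    then have "cfun.representation ?E (g (\<theta> b)) (\<theta> b)
       = (\<Sum>d\<in>D. ?RB (f b) d * (if \<theta> b = \<theta> d then 1 else 0))"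
      using indE
      by (subst \<open>g (\<theta> b) = _\<close>, subst cfun.representation_sum)
         (auto simp: cfun.representation_scale cfun.representation_basis cfun.span_base
             intro!: cfun.span_scale sum.cong)
    also have "\<dots> = (\<Sum>d\<in>D. if d = b then ?RB (f b) d else 0)"
      using inj that by (intro sum.cong) (auto simp: inj_on_def)
    also have "\<dots> = ?RB (f b) b" using that finD by simp
    finally show ?thesis .
  qed
  have repA: "?RB (f b) b = cfun.representation A (f b) b" if "b \<in> A" for b
    using cfun.representation_extend[OF B(2) _ B(1), of "f b"] A(2) AK fK that
    by (metis image_subset_iff subset_iff)
  have "trace_on V f = (\<Sum>b\<in>A. ?RB (f b) b) + (\<Sum>b\<in>D. ?RB (f b) b)"
    unfolding trace_on_eq_basis_sum[OF f B(2-4)] D_def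
    using sum.subset_diff[OF B(1) B(4)] by (simp add: add.commute)
  also have "(\<Sum>b\<in>A. ?RB (f b) b) = trace_on K f"
    using repA by (simp add: trace_on_eq_basis_sum[OF f(1) fK A])
  also have "(\<Sum>b\<in>D. ?RB (f b) b) = trace_on V' g"
    using repE finD
    by (simp add: trace_on_eq_basis_sum[OF g gV indE spanE] sum.reindex[OF inj])
  finally show ?thesis .
qed

lemma trace_on_conjugate:
  fixes V :: "('a \<Rightarrow> complex) set"
  assumes V: "cfun.subspace V" "finite S" "V \<subseteq> cfun.span S"
    and "lin f" "f ` V \<subseteq> V" "lin g" "lin h" "h ` V = V" "\<And>v. h v = 0 \<Longrightarrow> v = 0"
    and "\<And>v. v \<in> V \<Longrightarrow> h (f v) = g (h v)"
  shows "trace_on V f = trace_on V g"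
proof -
  interpret h: Vector_Spaces.linear fscale fscale h by fact
  have "{0} = {v \<in> V. h v = 0}" using assms(9) h.zero V(1) cfun.subspace_0 by auto
  have "trace_on V f = trace_on {0} f + trace_on V g"
    by (rule trace_on_exact_sequence[where \<theta> = h and S = S]) (fact | use assms(10) in blast)+
  then show ?thesis by (simp add: trace_on_zero_space)
qed

section \<open>Integer sequences\<close>

lemma Gam_upto_len:
  assumes "\<gamma> \<in> Gam" shows "\<gamma> \<in> Gam_upto (len \<gamma>)"
  using assms unfolding len_def Gam_def by (auto intro: LeastI)

lemma len_le: "\<gamma> \<in> Gam_upto L \<Longrightarrow> len \<gamma> \<le> L"
  unfolding len_def by (rule Least_le)

lemma Gam_uptoD: "\<gamma> \<in> Gam_upto L \<Longrightarrow> i > L \<Longrightarrow> \<gamma> i = 0"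
  and Gam_upto_0: "\<gamma> \<in> Gam_upto L \<Longrightarrow> \<gamma> 0 = 0"
  by (auto simp: Gam_upto_def)

lemma Gam_uptoI_Gam: "\<gamma> \<in> Gam_upto L \<Longrightarrow> \<gamma> \<in> Gam"
  by (auto simp: Gam_def)

section \<open>Products of disjoint cycles\<close>

text \<open>
  Lists of cycles are used instead of permutations with a cycle type, because all permutations in
  question come with explicit cycles, and fixed points must be counted as cycles of length 1.
\<close>

definition cycles_prod :: "'a list list \<Rightarrow> 'a \<Rightarrow> 'a" where
  "cycles_prod css = foldr (\<lambda>cs \<pi>. cycle_of_list cs \<circ> \<pi>) css id"

lemma cycles_prod_Nil [simp]: "cycles_prod [] = id"
  and cycles_prod_Cons [simp]: "cycles_prod (cs # css) = cycle_of_list cs \<circ> cycles_prod css"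
  by (simp_all add: cycles_prod_def)

lemma cycles_prod_append: "cycles_prod (css @ dss) = cycles_prod css \<circ> cycles_prod dss"
  by (induction css) (simp_all add: o_assoc)

lemma cycles_prod_permutes: "cycles_prod css permutes set (concat css)"
proof (induction css)
  case (Cons cs css)
  have "cycle_of_list cs permutes set (concat (cs # css))"
    by (rule permutes_subset[OF cycle_permutes]) auto
  moreover have "cycles_prod css permutes set (concat (cs # css))"
    by (rule permutes_subset[OF Cons.IH]) auto
  ultimately show ?case unfolding cycles_prod_Cons by (rule permutes_compose[rotated])
qed (metis cycles_prod_Nil permutes_id)

lemma cycles_prod_conjugate:
  assumes "bij p" "\<And>cs. cs \<in> set css \<Longrightarrow> distinct cs"
  shows "p \<circ> cycles_prod css \<circ> inv p = cycles_prod (map (map p) css)"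
  using assms(2)
proof (induction css)
  case Nil
  then show ?case using assms(1) by (metis bij_is_surj comp_id cycles_prod_Nil list.map(1) surj_iff)
next
  case (Cons cs css)
  have "p \<circ> cycles_prod (cs # css) \<circ> inv p
      = (p \<circ> cycle_of_list cs \<circ> inv p) \<circ> (p \<circ> cycles_prod css \<circ> inv p)"
    using assms(1) by (simp add: fun_eq_iff bij_is_inj)
  then show ?case using Cons conjugation_of_cycle[OF _ assms(1), of cs]
    by (metis cycles_prod_Cons list.set_intros list.simps(9))
qed

lemma cycle_commutes_cycles_prod:
  assumes "distinct cs" "distinct (concat dss)" "set cs \<inter> set (concat dss) = {}"
  shows "cycle_of_list cs \<circ> cycles_prod dss = cycles_prod dss \<circ> cycle_of_list cs"
  using assms(2,3)
proof (induction dss)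
  case (Cons ds dss)
  have 1: "cycle_of_list cs \<circ> cycle_of_list ds = cycle_of_list ds \<circ> cycle_of_list cs"
    using Cons.prems assms(1) by (intro cycles_commute) auto
  have 2: "cycle_of_list cs \<circ> cycles_prod dss = cycles_prod dss \<circ> cycle_of_list cs"
    using Cons.prems by (intro Cons.IH) auto
  show ?case unfolding cycles_prod_Cons by (metis 1 2 o_assoc)
qed simp

lemma cycles_prod_cong_mset:
  assumes "mset css = mset dss" "distinct (concat css)"
  shows "cycles_prod css = cycles_prod dss"
  using assms
proof (induction css arbitrary: dss)
  case (Cons cs css)
  have "cs \<in> set dss" using Cons.prems(1) by (metis list.set_intros(1) mset_eq_setD)
  then obtain ds1 ds2 where dss: "dss = ds1 @ cs # ds2" by (meson split_list)
  have m: "mset css = mset (ds1 @ ds2)" using Cons.prems(1) dss by simp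
  have dist: "distinct (concat css)" "distinct cs" "set cs \<inter> set (concat css) = {}"
    using Cons.prems by auto
  have "mset (concat css) = mset (concat (ds1 @ ds2))"
    using m by (metis mset_concat sum_mset_sum_list mset_map)
  then have d: "distinct (concat (ds1 @ ds2))" "set (concat css) = set (concat (ds1 @ ds2))"
    using dist by (metis mset_eq_imp_distinct_iff, metis mset_eq_setD)
  have "cycle_of_list cs \<circ> cycles_prod ds1 = cycles_prod ds1 \<circ> cycle_of_list cs"
    using dist d by (intro cycle_commutes_cycles_prod) auto
  moreover have "cycles_prod css = cycles_prod (ds1 @ ds2)" using Cons.IH m dist by blast
  ultimately show ?case by (simp add: dss cycles_prod_append fun_eq_iff)
qed simp

lemma obtain_permutation_of_lists:
  assumes "distinct xs" "distinct ys" "set xs = set ys"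
  obtains p where "p permutes set xs" "map p xs = ys"
proof -
  have len: "length xs = length ys" using assms by (metis distinct_card)
  define p where "p x = (if x \<in> set xs then the (map_of (zip xs ys) x) else x)" for x
  have map: "map p xs = ys"
    using len assms(1) by (intro nth_equalityI) (auto simp: p_def map_of_zip_nth)
  have "p ` set xs = set xs" using map assms(3) by (metis list.set_map)
  then have "bij_betw p (set xs) (set xs)"
    by (simp add: bij_betw_def eq_card_imp_inj_on)
  then have "p permutes set xs" by (rule bij_imp_permutes) (simp add: p_def)
  with map that show thesis by blast
qed

lemma concat_eq_lengths_imp_eq:
  "concat xss = concat yss \<Longrightarrow> map length xss = map length yss \<Longrightarrow> xss = yss"
  by (induction xss arbitrary: yss) (auto simp: Cons_eq_map_conv)

lemma mset_map_eq_imp_reordering: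
  assumes "mset (map f xs) = mset ys"
  obtains zs where "mset zs = mset xs" "map f zs = ys"
  using assms
proof (induction ys arbitrary: xs thesis)
  case Nil
  then show ?case by simp
next
  case (Cons y ys)
  have "y \<in> f ` set xs" using Cons.prems(2) by (metis list.set_intros(1) list.set_map mset_eq_setD)
  then obtain x where x: "x \<in> set xs" "y = f x" by auto
  then obtain as bs where xs: "xs = as @ x # bs" by (meson split_list)
  have "mset (map f (as @ bs)) = mset ys" using Cons.prems(2) xs x by simp
  then obtain zs where "mset zs = mset (as @ bs)" "map f zs = ys" using Cons.IH by blast
  then show ?case using Cons.prems(1)[of "x # zs"] x xs by simp
qed

text \<open>
  After reordering the disjoint cycles so that the lengths agree position by position, the
  conjugating permutation maps the concatenation of one list entrywise to that of the other.
\<close>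

lemma same_cycle_type_imp_conjugate:
  assumes "distinct (concat css)" "distinct (concat dss)"
    and "set (concat css) = A" "set (concat dss) = A"
    and "mset (map length css) = mset (map length dss)"
  obtains p where "p permutes A" "cycles_prod dss = p \<circ> cycles_prod css \<circ> inv p"
proof -
  obtain ess where ess: "mset ess = mset css" "map length ess = map length dss"
    using mset_map_eq_imp_reordering[OF assms(5)] by blast
  have prod: "cycles_prod css = cycles_prod ess"
    using cycles_prod_cong_mset[of css ess] ess assms(1) by simp
  have mc: "mset (concat ess) = mset (concat css)"
    using ess(1) by (metis mset_concat sum_mset_sum_list mset_map)
  then have d: "distinct (concat ess)" "set (concat ess) = A"
    using assms by (metis mset_eq_imp_distinct_iff, metis mset_eq_setD)
  obtain p where p: "p permutes A" "map p (concat ess) = concat dss"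
    using obtain_permutation_of_lists[of "concat ess" "concat dss"] d assms by metis
  have "concat (map (map p) ess) = concat dss" using p(2) by (simp add: map_concat)
  then have "map (map p) ess = dss"
    by (rule concat_eq_lengths_imp_eq) (simp add: ess(2)[symmetric] comp_def)
  moreover have "p \<circ> cycles_prod ess \<circ> inv p = cycles_prod (map (map p) ess)"
    using d(1) by (intro cycles_prod_conjugate permutes_bij[OF p(1)]) (simp add: distinct_concat_iff)
  ultimately have "cycles_prod dss = p \<circ> cycles_prod css \<circ> inv p"
    using prod by simp
  with p(1) that show thesis by blast
qed

lemma cycle_of_list_snoc:
  "cycle_of_list (cs @ [k, n]) = cycle_of_list (cs @ [k]) \<circ> transpose k n"
proof (induction cs)
  case (Cons c cs)
  then show ?case by (cases cs) (auto simp: fun_eq_iff)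
qed simp

text \<open>
  Rotating the cycle of \<open>k\<close> such that it ends with \<open>k\<close> and moving it to the end of the product turns
  the multiplication by \<open>(k n)\<close> on the right into appending \<open>n\<close> to this cycle.
\<close>

lemma cycles_prod_merge_point:
  assumes "distinct (concat css)" "n \<notin> set (concat css)" "j < length css" "k \<in> set (css ! j)"
  obtains dss where "distinct (concat dss)" "set (concat dss) = insert n (set (concat css))"
    "mset (map length dss) = mset ((map length css)[j := Suc (length (css ! j))])"
    "cycles_prod dss = cycles_prod css \<circ> transpose k n"
proof -
  define xs ys c where "xs = take j css" and "ys = drop (Suc j) css" and "c = css ! j"
  have css: "css = xs @ c # ys" and lx: "length xs = j"
    using assms(3) by (auto simp: xs_def ys_def c_def id_take_nth_drop[symmetric])
  obtain c1 c2 where c: "c = c1 @ k # c2" using assms(4) by (metis c_def split_list)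
  define c' where "c' = c2 @ c1"
  have dc: "distinct c" using assms(1) css by auto
  have rot: "cycle_of_list c = cycle_of_list (c' @ [k])"
    using cycle_of_list_rotate_independent[OF dc, of "Suc (length c1)"]
    by (simp add: c c'_def rotate_append)
  define dss where "dss = xs @ ys @ [c' @ [k, n]]"
  have m: "mset css = mset (xs @ ys @ [c])" by (simp add: css)
  have "cycles_prod css = cycles_prod (xs @ ys @ [c])"
    by (rule cycles_prod_cong_mset[OF m assms(1)])
  then have "cycles_prod dss = cycles_prod css \<circ> transpose k n"
    by (simp add: dss_def cycles_prod_append rot cycle_of_list_snoc o_assoc)
  moreover have "distinct (concat dss)"
    using assms(1,2) by (auto simp: dss_def css c c'_def)
  moreover have "set (concat dss) = insert n (set (concat css))"
    by (auto simp: dss_def css c c'_def)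
  moreover have "mset (map length dss) = mset ((map length css)[j := Suc (length (css ! j))])"
    using lx by (simp add: dss_def css c c'_def list_update_append nth_append)
  ultimately show thesis using that by blast
qed

definition cycle_blocks :: "nat \<Rightarrow> (nat \<Rightarrow> int) \<Rightarrow> nat list list" where
  "cycle_blocks L \<gamma> = map (\<lambda>j. map (cycle_entry \<gamma> j) [1..<Suc (nat (\<gamma> j))]) [1..<Suc L]"

lemma cycle_perm_eq_cycles_prod:
  assumes "\<gamma> \<in> Gam_upto L"
  shows "cycle_perm \<gamma> = cycles_prod (cycle_blocks L \<gamma>)"
proof -
  let ?b = "\<lambda>j. map (cycle_entry \<gamma> j) [1..<Suc (nat (\<gamma> j))]"
  have split: "[1..<Suc L] = [1..<Suc (len \<gamma>)] @ [Suc (len \<gamma>)..<Suc L]"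
    using upt_add_eq_append[of 1 "Suc (len \<gamma>)" "L - len \<gamma>"] len_le[OF assms] by (simp del: upt_Suc)
  have empty: "cycles_prod (map ?b js) = id" if "\<forall>j\<in>set js. \<gamma> j = 0" for js
    using that by (induction js) simp_all
  have "cycle_perm \<gamma> = cycles_prod (map ?b [1..<Suc (len \<gamma>)])"
    unfolding cycle_perm_def cycles_prod_def by (simp add: foldr_map comp_def)
  also have "\<dots> = cycles_prod (cycle_blocks L \<gamma>)"
    using empty[of "[Suc (len \<gamma>)..<Suc L]"] Gam_uptoD[OF Gam_upto_len[OF Gam_uptoI_Gam[OF assms]]]
    unfolding cycle_blocks_def split by (simp add: cycles_prod_append del: upt_Suc)
  finally show ?thesis .
qed

lemma concat_cycle_blocks: "concat (cycle_blocks L \<gamma>) = [1..<Suc (\<Sum>k = 1..L. nat (\<gamma> k))]"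
proof (induction L)
  case (Suc L)
  let ?s = "\<Sum>k = 1..L. nat (\<gamma> k)"
  have "map (cycle_entry \<gamma> (Suc L)) [1..<Suc (nat (\<gamma> (Suc L)))]
      = [Suc ?s..<Suc (?s + nat (\<gamma> (Suc L)))]"
    by (rule nth_equalityI)
       (simp_all add: cycle_entry_def atLeastLessThanSuc_atLeastAtMost del: upt_Suc)
  moreover have "[1..<Suc ?s] @ [Suc ?s..<Suc (?s + nat (\<gamma> (Suc L)))]
      = [1..<Suc (?s + nat (\<gamma> (Suc L)))]"
    by (metis Suc_le_mono le0 One_nat_def add_Suc upt_add_eq_append)
  moreover have "cycle_blocks (Suc L) \<gamma> = cycle_blocks L \<gamma> @
      [map (cycle_entry \<gamma> (Suc L)) [1..<Suc (nat (\<gamma> (Suc L)))]]"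
    unfolding cycle_blocks_def by (simp del: upt_Suc add: upt_Suc_append)
  ultimately show ?case using Suc.IH by (simp del: upt_Suc)
qed (simp add: cycle_blocks_def)

lemma length_cycle_blocks: "map length (cycle_blocks L \<gamma>) = map (\<lambda>j. nat (\<gamma> j)) [1..<Suc L]"
  by (simp add: cycle_blocks_def comp_def del: upt_Suc)

lemma cycle_perm_permutes:
  assumes "\<gamma> \<in> Gam_upto L"
  shows "cycle_perm \<gamma> permutes {1..\<Sum>k = 1..L. nat (\<gamma> k)}"
  using cycles_prod_permutes[of "cycle_blocks L \<gamma>"]
  unfolding cycle_perm_eq_cycles_prod[OF assms] concat_cycle_blocks
  by (simp add: atLeastLessThanSuc_atLeastAtMost del: upt_Suc)

lemma cycle_perm_conjugate:
  assumes "\<gamma> \<in> Gam_upto L" "\<delta> \<in> Gam_upto L"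
    and m: "mset (map (\<lambda>j. nat (\<gamma> j)) [1..<Suc L]) = mset (map (\<lambda>j. nat (\<delta> j)) [1..<Suc L])"
    and N: "N = (\<Sum>k = 1..L. nat (\<gamma> k))"
  obtains p where "p permutes {1..N}" "cycle_perm \<delta> = p \<circ> cycle_perm \<gamma> \<circ> inv p"
proof -
  have sum: "(\<Sum>k = 1..L. nat (\<gamma> k)) = sum_mset (mset (map (\<lambda>j. nat (\<gamma> j)) [1..<Suc L]))" for \<gamma> :: "nat \<Rightarrow> int"
    unfolding sum_mset_sum_list interv_sum_list_conv_sum_set_nat set_upt
      atLeastLessThanSuc_atLeastAtMost ..
  have N2: "N = (\<Sum>k = 1..L. nat (\<delta> k))" using m unfolding N sum by simp
  show thesis
  proof (rule same_cycle_type_imp_conjugate[of "cycle_blocks L \<gamma>" "cycle_blocks L \<delta>" "{1..N}"])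
    show "set (concat (cycle_blocks L \<gamma>)) = {1..N}"
      unfolding concat_cycle_blocks N by auto
    show "set (concat (cycle_blocks L \<delta>)) = {1..N}"
      unfolding concat_cycle_blocks N2 by auto
    show "mset (map length (cycle_blocks L \<gamma>)) = mset (map length (cycle_blocks L \<delta>))"
      unfolding length_cycle_blocks by (rule m)
  qed (use that assms in \<open>auto simp: concat_cycle_blocks cycle_perm_eq_cycles_prod simp del: upt_Suc\<close>)
qed

lemma sum_list_map_concat:
  "sum_list (map f (concat xss)) = sum_list (map (\<lambda>xs. sum_list (map f xs)) xss)"
  by (induction xss) simp_all

text \<open>
  The point \<open>k\<close> lies in the block of one \<open>j\<close>, and then \<open>n\<close> is merged into this block, which has \<open>\<gamma> j\<close>
  points. Entries of \<open>\<gamma>\<close> that are 0 have empty blocks and coefficient 0.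
\<close>

lemma sum_class_function_merge_point:
  fixes \<chi> :: "(nat \<Rightarrow> nat) \<Rightarrow> complex"
  assumes \<gamma>: "\<gamma> \<in> Gam_upto L" "\<And>j. \<gamma> j \<ge> 0" and n: "n = Suc (\<Sum>k = 1..L. nat (\<gamma> k))"
    and cf: "\<And>p \<sigma>. p permutes {1..n} \<Longrightarrow> \<sigma> permutes {1..n} \<Longrightarrow> \<chi> (p \<circ> \<sigma> \<circ> inv p) = \<chi> \<sigma>"
  shows "(\<Sum>k = 1..<n. \<chi> (cycle_perm \<gamma> \<circ> transpose k n))
       = (\<Sum>j = 1..L. of_int (\<gamma> j) * \<chi> (cycle_perm (\<gamma> + eps j)))"
proof -
  let ?B = "cycle_blocks L \<gamma>"
  let ?h = "\<lambda>k. \<chi> (cycle_perm \<gamma> \<circ> transpose k n)"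
  let ?b = "\<lambda>j. map (cycle_entry \<gamma> j) [1..<Suc (nat (\<gamma> j))]"
  have conc: "concat ?B = [1..<n]" unfolding concat_cycle_blocks n ..
  have val: "?h k = \<chi> (cycle_perm (\<gamma> + eps j))" if j: "j \<in> {1..L}" and k: "k \<in> set (?b j)" for j k
  proof -
    have j': "j - 1 < length ?B" using j by (auto simp: cycle_blocks_def simp del: upt_Suc)
    have Bj: "?B ! (j - 1) = ?b j"
      using j by (auto simp: cycle_blocks_def nth_map simp del: upt_Suc)
    have k': "k \<in> set (?B ! (j - 1))" unfolding Bj by (rule k)
    obtain dss where dss: "distinct (concat dss)" "set (concat dss) = insert n (set (concat ?B))"
      "mset (map length dss) = mset ((map length ?B)[j - 1 := Suc (length (?B ! (j - 1)))])"
      "cycles_prod dss = cycles_prod ?B \<circ> transpose k n"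
      by (rule cycles_prod_merge_point[of ?B n "j - 1" k])
         (use j' k' in \<open>simp_all add: conc del: upt_Suc\<close>)
    let ?d = "\<gamma> + eps j"
    have dU: "?d \<in> Gam_upto L" using \<gamma>(1) j by (auto simp: Gam_upto_def eps_def)
    have sd: "(\<Sum>k = 1..L. nat (?d k)) = n"
    proof -
      have "(\<Sum>k = 1..L. nat (?d k)) = (\<Sum>k = 1..L. nat (\<gamma> k) + (if k = j then 1 else 0))"
        using \<gamma>(2) by (intro sum.cong) (auto simp: eps_def nat_add_distrib)
      also have "\<dots> = n" using j by (simp add: sum.distrib n)
      finally show ?thesis .
    qed
    have lens: "map length (cycle_blocks L ?d) = (map length ?B)[j - 1 := Suc (length (?B ! (j - 1)))]"
      using j \<gamma>(2) unfolding Bj length_cycle_blocks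
      by (intro nth_equalityI) (auto simp: nth_list_update eps_def nat_add_distrib simp del: upt_Suc)
    obtain p where p: "p permutes {1..n}"
        "cycles_prod (cycle_blocks L ?d) = p \<circ> cycles_prod dss \<circ> inv p"
    proof (rule same_cycle_type_imp_conjugate[of dss "cycle_blocks L ?d" "{1..n}"])
      show "set (concat dss) = {1..n}" using dss(2) conc n by (auto simp del: upt_Suc)
      show "distinct (concat (cycle_blocks L ?d))" "set (concat (cycle_blocks L ?d)) = {1..n}"
        unfolding concat_cycle_blocks sd by auto
      show "mset (map length dss) = mset (map length (cycle_blocks L ?d))"
        unfolding lens by (rule dss(3))
    qed (use dss in auto)
    have "insert n (set (concat ?B)) = {1..n}" using conc n by (auto simp del: upt_Suc)
    then have "cycles_prod dss permutes {1..n}"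
      using cycles_prod_permutes[of dss] dss(2) by metis
    then have "\<chi> (cycle_perm ?d) = \<chi> (cycles_prod dss)"
      unfolding cycle_perm_eq_cycles_prod[OF dU] p(2) using cf p(1) by blast
    then show ?thesis using dss(4) by (simp add: cycle_perm_eq_cycles_prod[OF \<gamma>(1)])
  qed
  have "(\<Sum>k = 1..<n. ?h k) = sum_list (map ?h (concat ?B))"
    unfolding conc interv_sum_list_conv_sum_set_nat by simp
  also have "\<dots> = sum_list (map (\<lambda>j. sum_list (map ?h (?b j))) [1..<Suc L])"
    unfolding sum_list_map_concat by (simp add: cycle_blocks_def comp_def del: upt_Suc)
  also have "\<dots> = (\<Sum>j = 1..L. sum_list (map ?h (?b j)))"
    unfolding interv_sum_list_conv_sum_set_nat set_upt atLeastLessThanSuc_atLeastAtMost ..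
  also have "\<dots> = (\<Sum>j = 1..L. of_int (\<gamma> j) * \<chi> (cycle_perm (\<gamma> + eps j)))"
  proof (rule sum.cong[OF refl])
    fix j assume j: "j \<in> {1..L}"
    have "map ?h (?b j) = map (\<lambda>_. \<chi> (cycle_perm (\<gamma> + eps j))) (?b j)"
      using val[OF j] by (intro map_cong refl)
    then have "sum_list (map ?h (?b j)) = of_nat (length (?b j)) * \<chi> (cycle_perm (\<gamma> + eps j))"
      by (simp only: sum_list_triv map_replicate_const sum_list_replicate)
    then show "sum_list (map ?h (?b j)) = of_int (\<gamma> j) * \<chi> (cycle_perm (\<gamma> + eps j))"
      using \<gamma>(2)[of j] by (simp del: upt_Suc)
  qed
  finally show ?thesis .
qed

text \<open>
  The last block has a single point, and a cycle of length 1 is the identity.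
\<close>

lemma cycle_perm_drop_final_one:
  assumes "\<beta> \<in> Gam_upto m" "m \<ge> 1" "\<beta> m = 1"
  shows "cycle_perm \<beta> = cycle_perm (\<beta> - eps m)"
proof -
  obtain l where m: "m = Suc l" using assms(2) by (cases m) auto
  have "\<beta> - eps m \<in> Gam_upto l"
    using assms by (auto simp: Gam_upto_def eps_def m)
  moreover have "cycle_blocks l (\<beta> - eps m) = cycle_blocks l \<beta>"
  proof -
    have "cycle_entry (\<beta> - eps m) j i = cycle_entry \<beta> j i" if "j \<le> l" for i j
      unfolding cycle_entry_def using that by (intro arg_cong2[of _ _ _ _ "(+)"] sum.cong) (auto simp: eps_def m)
    moreover have "(\<beta> - eps m) j = \<beta> j" if "j \<le> l" for j using that by (simp add: eps_def m)
    ultimately show ?thesis unfolding cycle_blocks_def by (intro map_cong refl) (auto simp del: upt_Suc)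
  qed
  moreover have "cycle_blocks m \<beta> = cycle_blocks l \<beta> @ [[cycle_entry \<beta> m 1]]"
    using assms(3) by (simp add: cycle_blocks_def m)
  ultimately show ?thesis
    using assms(1) by (simp add: cycle_perm_eq_cycles_prod cycles_prod_append)
qed

section \<open>The action of permutations on tabloids\<close>

lemma eq_uminus_imp_zero: "(x::complex) = - x \<Longrightarrow> x = 0"
  by (simp add: eq_neg_iff_add_eq_0)

lemma lin_perm_action: "lin (perm_action \<sigma>)"
  by (rule linI) (simp_all add: perm_action_def fscale_def fun_eq_iff)

lemma perm_action_compose:
  assumes "bij \<sigma>" "bij \<tau>"
  shows "perm_action (\<sigma> \<circ> \<tau>) v = perm_action \<sigma> (perm_action \<tau> v)"
  using assms by (simp add: perm_action_def o_inv_distrib image_comp)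

lemma perm_action_id: "perm_action id v = v"
  by (simp add: perm_action_def)

lemma perm_action_tabloid_vec:
  assumes "bij \<sigma>"
  shows "perm_action \<sigma> (tabloid_vec T) = tabloid_vec (\<lambda>i. \<sigma> ` T i)"
proof
  fix U
  have "(\<lambda>i. inv \<sigma> ` U i) = T \<longleftrightarrow> U = (\<lambda>i. \<sigma> ` T i)"
    unfolding fun_eq_iff using assms
    by (metis bij_is_inj bij_is_surj image_f_inv_f image_inv_f_f)
  then show "perm_action \<sigma> (tabloid_vec T) U = tabloid_vec (\<lambda>i. \<sigma> ` T i) U"
    by (simp add: perm_action_def tabloid_vec_def)
qed

lemma row_set_comp: "row_set \<alpha> (\<sigma> \<circ> t) = (\<lambda>i. \<sigma> ` row_set \<alpha> t i)"
  and col_set_comp: "col_set \<alpha> (\<sigma> \<circ> t) = (\<lambda>j. \<sigma> ` col_set \<alpha> t j)"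
  by (auto simp: row_set_def col_set_def fun_eq_iff)

lemma sum_fun_apply: "(\<Sum>i\<in>I. f i) x = (\<Sum>i\<in>I. f i x :: complex)"
  by (induction I rule: infinite_finite_induct) simp_all

section \<open>Tableaux and polytabloids\<close>

text \<open>
  A tableau is a function on all pairs of numbers. Its values outside the diagram are arbitrary, and
  the polytabloid \<open>e t\<close> does not depend on them.
\<close>

locale partition_shape =
  fixes \<alpha> :: "nat \<Rightarrow> int" and n :: nat
  assumes part: "partition_of \<alpha> n"
begin

abbreviation "D \<equiv> diagram \<alpha>"
abbreviation "C \<equiv> column_stabilizer \<alpha>"
abbreviation "e \<equiv> polytabloid \<alpha>"

lemma Gam_alpha: "\<alpha> \<in> Gam_upto (len \<alpha>)"
  using part Gam_upto_len by (auto simp: partition_of_def Gam_nonneg_def)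

lemma alpha_0 [simp]: "\<alpha> 0 = 0"
  using Gam_alpha Gam_upto_0 by blast

lemma alpha_nonneg: "\<alpha> i \<ge> 0"
  using part by (cases "i = 0") (auto simp: partition_of_def Gam_nonneg_def)

lemma alpha_antimono:
  assumes "1 \<le> i" "i \<le> j" shows "\<alpha> j \<le> \<alpha> i"
  using assms(2)
proof (induction rule: dec_induct)
  case (step j)
  then have "\<alpha> (j + 1) \<le> \<alpha> j" using part assms(1) by (auto simp: partition_of_def)
  with step show ?case by simp
qed simp

lemma nat_weight [simp]: "nat (weight \<alpha>) = n"
  using part by (simp add: partition_of_def)

lemma diagram_iff: "(i, j) \<in> D \<longleftrightarrow> 1 \<le> i \<and> 1 \<le> j \<and> int j \<le> \<alpha> i"
  by (simp add: diagram_def)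

lemma diagram_down:
  assumes "(i, j) \<in> D" "1 \<le> i'" "i' \<le> i" "1 \<le> j'" "j' \<le> j"
  shows "(i', j') \<in> D"
  using assms alpha_antimono[of i' i] by (auto simp: diagram_iff)

lemma diagram_row_le: "(i, j) \<in> D \<Longrightarrow> i \<le> len \<alpha>"
  using Gam_uptoD[OF Gam_alpha, of i] by (force simp: diagram_iff)

lemma diagram_col_le: "(i, j) \<in> D \<Longrightarrow> j \<le> nat (\<alpha> 1)"
  using alpha_antimono[of 1 i] by (auto simp: diagram_iff)

lemma tableau_iff: "tableau \<alpha> t \<longleftrightarrow> bij_betw t D {1..n}"
  by (simp add: tableau_def)

lemma tableau_comp: "tableau \<alpha> t \<Longrightarrow> \<sigma> permutes {1..n} \<Longrightarrow> tableau \<alpha> (\<sigma> \<circ> t)"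
  unfolding tableau_iff using bij_betw_trans permutes_imp_bij by blast

lemma tableau_inj: "tableau \<alpha> t \<Longrightarrow> x \<in> D \<Longrightarrow> y \<in> D \<Longrightarrow> t x = t y \<longleftrightarrow> x = y"
  by (auto simp: tableau_iff bij_betw_def inj_on_def)

lemma tableau_in: "tableau \<alpha> t \<Longrightarrow> x \<in> D \<Longrightarrow> t x \<in> {1..n}"
  by (auto simp: tableau_iff bij_betw_def)

lemma tableau_surj:
  assumes "tableau \<alpha> t" "x \<in> {1..n}"
  obtains i j where "(i, j) \<in> D" "t (i, j) = x"
proof -
  have "x \<in> t ` D" using assms by (simp add: tableau_iff bij_betw_def)
  with that show thesis by auto
qed

lemma column_stabilizer_iff:
  "\<pi> \<in> C t \<longleftrightarrow> \<pi> permutes {1..n} \<and> (\<forall>j\<ge>1. \<pi> ` col_set \<alpha> t j = col_set \<alpha> t j)"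
  by (simp add: column_stabilizer_def)

lemma column_stabilizer_permutes: "\<pi> \<in> C t \<Longrightarrow> \<pi> permutes {1..n}"
  by (simp add: column_stabilizer_iff)

lemma finite_column_stabilizer: "finite (C t)"
  by (rule finite_subset[OF _ finite_permutations[of "{1..n}"]]) (auto simp: column_stabilizer_iff)

lemma col_set_subset: "tableau \<alpha> t \<Longrightarrow> col_set \<alpha> t c \<subseteq> {1..n}"
  using tableau_in by (force simp: col_set_def)

lemma finite_col_set: "tableau \<alpha> t \<Longrightarrow> finite (col_set \<alpha> t c)"
  using col_set_subset finite_subset by blast

lemma col_setI: "(i, c) \<in> D \<Longrightarrow> t (i, c) \<in> col_set \<alpha> t c"
  by (auto simp: col_set_def)

lemma col_set_iff: "tableau \<alpha> t \<Longrightarrow> (i, j) \<in> D \<Longrightarrow> t (i, j) \<in> col_set \<alpha> t c \<longleftrightarrow> j = c"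
  using tableau_inj by (fastforce simp: col_set_def)

lemma row_set_iff: "tableau \<alpha> t \<Longrightarrow> (i, j) \<in> D \<Longrightarrow> t (i, j) \<in> row_set \<alpha> t r \<longleftrightarrow> i = r"
  using tableau_inj by (fastforce simp: row_set_def)

lemma col_set_disjoint: "tableau \<alpha> t \<Longrightarrow> c \<noteq> c' \<Longrightarrow> col_set \<alpha> t c \<inter> col_set \<alpha> t c' = {}"
  using tableau_inj by (fastforce simp: col_set_def)

lemma permutes_column_imp_stabilizer:
  assumes t: "tableau \<alpha> t" and q: "q permutes col_set \<alpha> t c"
  shows "q \<in> C t"
proof -
  have "q permutes {1..n}" using q col_set_subset[OF t] permutes_subset by blast
  moreover have "q ` col_set \<alpha> t j = col_set \<alpha> t j" for j
  proof (cases "j = c")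
    case True
    then show ?thesis using permutes_image[OF q] by simp
  next
    case False
    then have "q x = x" if "x \<in> col_set \<alpha> t j" for x
      using q that col_set_disjoint[OF t False] by (auto simp: permutes_def)
    then show ?thesis by auto
  qed
  ultimately show ?thesis by (simp add: column_stabilizer_iff)
qed

lemma transpose_in_stabilizer:
  assumes "tableau \<alpha> t" "x \<in> col_set \<alpha> t c" "y \<in> col_set \<alpha> t c"
  shows "transpose x y \<in> C t"
  using permutes_column_imp_stabilizer[OF assms(1) permutes_swap_id[OF assms(2,3)]] .

lemma stabilizer_comp:
  assumes "\<pi> \<in> C t" "\<rho> \<in> C t" shows "\<pi> \<circ> \<rho> \<in> C t"
proof -
  have "(\<pi> \<circ> \<rho>) ` col_set \<alpha> t j = col_set \<alpha> t j" if "1 \<le> j" for j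
    using assms that unfolding column_stabilizer_iff by (metis image_comp)
  then show ?thesis
    using assms permutes_compose[of \<rho> "{1..n}" \<pi>] by (simp add: column_stabilizer_iff)
qed

lemma stabilizer_inv:
  assumes "\<pi> \<in> C t" shows "inv \<pi> \<in> C t"
proof -
  have p: "\<pi> permutes {1..n}" using assms by (simp add: column_stabilizer_iff)
  have "inv \<pi> ` col_set \<alpha> t j = col_set \<alpha> t j" if "j \<ge> 1" for j
    using assms that by (metis column_stabilizer_iff image_inv_f_f permutes_inj p)
  then show ?thesis using permutes_inv[OF p] by (simp add: column_stabilizer_iff)
qed

lemma column_stabilizer_conj:
  assumes s: "\<sigma> permutes {1..n}"
  shows "C (\<sigma> \<circ> t) = (\<lambda>\<pi>. \<sigma> \<circ> \<pi> \<circ> inv \<sigma>) ` C t"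
proof -
  have sub: "\<sigma> \<circ> \<pi> \<circ> inv \<sigma> \<in> C (\<sigma> \<circ> t)" if s: "\<sigma> permutes {1..n}" and "\<pi> \<in> C t" for \<sigma> \<pi> t
  proof -
    have "\<pi> permutes {1..n}" using that by (simp add: column_stabilizer_iff)
    then have "\<sigma> \<circ> \<pi> \<circ> inv \<sigma> permutes {1..n}"
      using s by (intro permutes_compose permutes_inv)
    moreover have "(\<sigma> \<circ> \<pi> \<circ> inv \<sigma>) ` \<sigma> ` X = \<sigma> ` \<pi> ` X" for X
      using permutes_inverses(2)[OF s] by (simp add: image_image)
    ultimately show ?thesis using that(2) by (simp add: column_stabilizer_iff col_set_comp)
  qed
  show ?thesis
  proof
    show "(\<lambda>\<pi>. \<sigma> \<circ> \<pi> \<circ> inv \<sigma>) ` C t \<subseteq> C (\<sigma> \<circ> t)" using sub[OF s] by blast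
    show "C (\<sigma> \<circ> t) \<subseteq> (\<lambda>\<pi>. \<sigma> \<circ> \<pi> \<circ> inv \<sigma>) ` C t"
    proof
      fix \<rho> assume "\<rho> \<in> C (\<sigma> \<circ> t)"
      from sub[OF permutes_inv[OF s] this] have "inv \<sigma> \<circ> \<rho> \<circ> \<sigma> \<in> C t"
        using permutes_inv_o(2)[OF s] by (simp add: permutes_inv_inv[OF s] o_assoc)
      moreover have "\<rho> = \<sigma> \<circ> (inv \<sigma> \<circ> \<rho> \<circ> \<sigma>) \<circ> inv \<sigma>"
        using permutes_inv_o(1)[OF s] by (simp add: o_assoc) (simp add: o_assoc[symmetric])
      ultimately show "\<rho> \<in> (\<lambda>\<pi>. \<sigma> \<circ> \<pi> \<circ> inv \<sigma>) ` C t" by blast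
    qed
  qed
qed

lemma permutation_of_permutes: "\<sigma> permutes {1..n} \<Longrightarrow> permutation \<sigma>"
  unfolding permutation_permutes by blast

lemma sign_compose_permutes:
  "\<sigma> permutes {1..n} \<Longrightarrow> \<tau> permutes {1..n} \<Longrightarrow> sign (\<sigma> \<circ> \<tau>) = sign \<sigma> * sign \<tau>"
  by (intro sign_compose permutation_of_permutes)

text \<open>
  Conjugation by \<open>\<sigma>\<close> takes the column stabilizer of \<open>t\<close> to that of \<open>\<sigma> \<circ> t\<close> and preserves signs.
\<close>

lemma perm_action_polytabloid:
  assumes s: "\<sigma> permutes {1..n}"
  shows "perm_action \<sigma> (e t) = e (\<sigma> \<circ> t)"
proof -
  interpret l: Vector_Spaces.linear fscale fscale "perm_action \<sigma>" by (rule lin_perm_action)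
  have inj: "inj_on (\<lambda>\<pi>. \<sigma> \<circ> \<pi> \<circ> inv \<sigma>) (C t)"
  proof
    fix \<pi> \<rho> assume "\<sigma> \<circ> \<pi> \<circ> inv \<sigma> = \<sigma> \<circ> \<rho> \<circ> inv \<sigma>"
    then have "\<sigma> (\<pi> x) = \<sigma> (\<rho> x)" for x
      using permutes_inverses(2)[OF s] by (metis comp_apply)
    then show "\<pi> = \<rho>" using permutes_inj[OF s] by (auto simp: inj_def)
  qed
  have sgn: "sign (\<sigma> \<circ> \<pi> \<circ> inv \<sigma>) = sign \<pi>" if "\<pi> \<in> C t" for \<pi>
  proof -
    have p: "\<pi> permutes {1..n}" by (rule column_stabilizer_permutes[OF that])
    have "sign (\<sigma> \<circ> \<pi> \<circ> inv \<sigma>) = sign \<sigma> * sign \<pi> * sign (inv \<sigma>)"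
      using s p by (simp add: sign_compose_permutes permutes_compose permutes_inv)
    then show ?thesis using s by (simp add: sign_inverse permutation_of_permutes)
  qed
  have "perm_action \<sigma> (e t) = (\<Sum>\<pi>\<in>C t. fscale (of_int (sign \<pi>))
      (tabloid_vec (row_set \<alpha> ((\<sigma> \<circ> \<pi> \<circ> inv \<sigma>) \<circ> (\<sigma> \<circ> t)))))"
    unfolding polytabloid_def l.sum l.scale perm_action_tabloid_vec[OF permutes_bij[OF s]]
      row_set_comp[symmetric]
    using permutes_inv_o(2)[OF s] by (simp add: o_assoc[symmetric]) (simp add: o_assoc)
  also have "\<dots> = e (\<sigma> \<circ> t)"
    unfolding polytabloid_def column_stabilizer_conj[OF s] sum.reindex[OF inj]
    by (intro sum.cong refl) (simp add: sgn)
  finally show ?thesis .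
qed

lemma polytabloid_stabilizer:
  assumes q: "q \<in> C t"
  shows "e (q \<circ> t) = fscale (of_int (sign q)) (e t)"
proof -
  have qp: "q permutes {1..n}" using q by (rule column_stabilizer_permutes)
  have Ceq: "C (q \<circ> t) = C t"
    using q by (auto simp: column_stabilizer_iff col_set_comp)
  have summand: "fscale (of_int (sign \<pi>)) (tabloid_vec (row_set \<alpha> (\<pi> \<circ> (q \<circ> t))))
     = fscale (of_int (sign q)) (fscale (of_int (sign (\<pi> \<circ> q))) (tabloid_vec (row_set \<alpha> ((\<pi> \<circ> q) \<circ> t))))"
    if "\<pi> \<in> C t" for \<pi>
  proof -
    have "sign q * sign (\<pi> \<circ> q) = sign \<pi> * (sign q * sign q)"
      using sign_compose_permutes[OF column_stabilizer_permutes[OF that] qp] by simp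
    then have "sign q * sign (\<pi> \<circ> q) = sign \<pi>" by (simp add: sign_idempotent)
    then have "of_int (sign q) * of_int (sign (\<pi> \<circ> q)) = (of_int (sign \<pi>) :: complex)"
      by (metis of_int_mult)
    then show ?thesis by (simp add: o_assoc)
  qed
  have "e (q \<circ> t) = (\<Sum>\<pi>\<in>C t. fscale (of_int (sign q)) (fscale (of_int (sign (\<pi> \<circ> q)))
       (tabloid_vec (row_set \<alpha> ((\<pi> \<circ> q) \<circ> t)))))"
    unfolding polytabloid_def[of _ "q \<circ> t"] Ceq using summand by (intro sum.cong refl) 
  also have "\<dots> = (\<Sum>\<pi>\<in>C t. fscale (of_int (sign q)) (fscale (of_int (sign \<pi>))
       (tabloid_vec (row_set \<alpha> (\<pi> \<circ> t)))))"
  proof (rule sum.reindex_bij_witness[of _ "\<lambda>\<pi>. \<pi> \<circ> inv q" "\<lambda>\<pi>. \<pi> \<circ> q"])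
  qed (use q qp stabilizer_inv[OF q] stabilizer_comp in
      \<open>auto simp: o_assoc[symmetric] permutes_inv_o[OF qp]\<close>)
  also have "\<dots> = fscale (of_int (sign q)) (e t)"
    unfolding polytabloid_def cfun.scale_sum_right ..
  finally show ?thesis .
qed

lemma polytabloid_apply:
  "e t T = (\<Sum>\<pi>\<in>C t. if T = row_set \<alpha> (\<pi> \<circ> t) then of_int (sign \<pi>) else 0)"
proof -
  have "e t T = (\<Sum>\<pi>\<in>C t. fscale (of_int (sign \<pi>)) (tabloid_vec (row_set \<alpha> (\<pi> \<circ> t))) T)"
    unfolding polytabloid_def by (induction rule: finite_induct[OF finite_column_stabilizer[of t]]) simp_all
  also have "\<dots> = (\<Sum>\<pi>\<in>C t. if T = row_set \<alpha> (\<pi> \<circ> t) then of_int (sign \<pi>) else 0)"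
    by (intro sum.cong) (simp_all add: fscale_def tabloid_vec_def)
  finally show ?thesis .
qed

lemma stabilizer_column:
  assumes "tableau \<alpha> t" "\<pi> \<in> C t" "(i, j) \<in> D" "(i', j') \<in> D" "\<pi> (t (i, j)) = t (i', j')"
  shows "j = j'"
proof -
  have "t (i', j') \<in> \<pi> ` col_set \<alpha> t j" using assms(3,5) col_setI by (metis image_eqI)
  also have "\<dots> = col_set \<alpha> t j" using assms(2,3) by (simp add: column_stabilizer_iff diagram_iff)
  finally show ?thesis using col_set_iff[OF assms(1,4)] by simp
qed

section \<open>A Garnir relation that moves a single entry\<close>

text \<open>
  Composing with the transposition of two points in the same row does not change the tabloid but
  changes the sign, so the terms cancel in pairs. \<open>R\<close> is a tabloid.
\<close>

lemma antisymmetrizer_kills_shared_row: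
  assumes fin: "finite B" and xy: "x \<in> B" "y \<in> B" "x \<noteq> y" and R: "x \<in> R i" "y \<in> R i"
    and dis: "\<And>j. j \<noteq> i \<Longrightarrow> x \<notin> R j \<and> y \<notin> R j"
  shows "(\<Sum>g | g permutes B. fscale (of_int (sign g)) (tabloid_vec (\<lambda>j. g ` R j))) = 0"
proof
  fix T
  let ?f = "\<lambda>g. fscale (of_int (sign g)) (tabloid_vec (\<lambda>j. g ` R j)) T"
  let ?s = "transpose x y"
  let ?P = "{g. g permutes B}"
  have finP: "finite ?P" using fin by (rule finite_permutations)
  have s: "?s permutes B" using xy by (simp add: permutes_swap_id)
  have sR: "?s ` R j = R j" for j
    using R dis[of j] by (cases "j = i") (auto simp: transpose_def image_iff)
  have "(\<Sum>g\<in>?P. ?f g) = (\<Sum>g\<in>?P. ?f (g \<circ> ?s))"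
    by (rule sum.reindex_bij_witness[of _ "\<lambda>g. g \<circ> ?s" "\<lambda>g. g \<circ> ?s"])
       (use permutes_compose[OF s] in \<open>auto simp: o_assoc[symmetric]\<close>)
  also have "\<dots> = (\<Sum>g\<in>?P. - ?f g)"
  proof (rule sum.cong[OF refl])
    fix g assume "g \<in> ?P"
    then have "permutation g" using fin permutation_permutes by blast
    then have "sign (g \<circ> ?s) = - sign g"
      using xy(3) by (simp add: sign_compose permutation_swap_id sign_swap_id)
    moreover have "(\<lambda>j. (g \<circ> ?s) ` R j) = (\<lambda>j. g ` R j)"
      using sR by (simp only: image_comp[symmetric])
    ultimately show "?f (g \<circ> ?s) = - ?f g" by (simp add: fscale_def)
  qed
  finally have "(\<Sum>g\<in>?P. ?f g) = - (\<Sum>g\<in>?P. ?f g)" by (simp add: sum_negf)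
  then have "(\<Sum>g\<in>?P. ?f g) = 0" by (rule eq_uminus_imp_zero)
  moreover have "(\<Sum>g\<in>?P. fscale (of_int (sign g)) (tabloid_vec (\<lambda>j. g ` R j))) T = (\<Sum>g\<in>?P. ?f g)"
    by (induction rule: finite_induct[OF finP]) simp_all
  ultimately show "(\<Sum>g\<in>?P. fscale (of_int (sign g)) (tabloid_vec (\<lambda>j. g ` R j))) T = 0 T"
    by simp
qed

text \<open>
  A Garnir relation for the single entry \<open>a\<close> of column \<open>c\<close> and all of column \<open>c'\<close>. In every tabloid that
  occurs in \<open>e t\<close>, the row of \<open>a\<close> also contains an entry of column \<open>c'\<close>, as this column is at least as
  long. Hence the antisymmetrizer of column \<open>c'\<close> together with \<open>a\<close> annihilates \<open>e t\<close>. It factors into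
  the transpositions \<open>(a b)\<close> and the antisymmetrizer of column \<open>c'\<close>, and the latter multiplies \<open>e t\<close> by
  the number of permutations of the column.
  
  The two cases that are needed are \<open>c' < c\<close> and neighbouring columns of equal length.
\<close>

lemma garnir_one_cell:
  assumes t: "tableau \<alpha> t" and c: "c \<noteq> c'" "1 \<le> c" "1 \<le> c'" and a: "a \<in> col_set \<alpha> t c"
    and longer: "\<And>i. (i, c) \<in> D \<Longrightarrow> (i, c') \<in> D"
  shows "e t = (\<Sum>b\<in>col_set \<alpha> t c'. e (transpose a b \<circ> t))"
proof -
  let ?B = "col_set \<alpha> t c'"
  have finB: "finite ?B" by (rule finite_col_set[OF t])
  have aB: "a \<notin> ?B" using col_set_disjoint[OF t c(1)] a by blast
  have an: "a \<in> {1..n}" using a col_set_subset[OF t] by blast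
  have sub: "insert a ?B \<subseteq> {1..n}" using an col_set_subset[OF t] by blast
  let ?f = "\<lambda>g. fscale (of_int (sign g)) (e (g \<circ> t))"
  have kill: "(\<Sum>g | g permutes insert a ?B. fscale (of_int (sign g))
        (tabloid_vec (\<lambda>j. g ` row_set \<alpha> (\<pi> \<circ> t) j))) = 0" if p: "\<pi> \<in> C t" for \<pi>
  proof -
    have pp: "\<pi> permutes {1..n}" by (rule column_stabilizer_permutes[OF p])
    have pt: "tableau \<alpha> (\<pi> \<circ> t)" by (rule tableau_comp[OF t pp])
    have "a \<in> \<pi> ` col_set \<alpha> t c" using p a c by (simp add: column_stabilizer_iff)
    then obtain i where i: "(i, c) \<in> D" "a = (\<pi> \<circ> t) (i, c)" by (auto simp: col_set_def)
    have i': "(i, c') \<in> D" by (rule longer[OF i(1)])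
    define y where "y = (\<pi> \<circ> t) (i, c')"
    have "y \<in> \<pi> ` col_set \<alpha> t c'" unfolding y_def using col_setI[OF i', of t] by auto
    then have yB: "y \<in> ?B" using p c by (simp add: column_stabilizer_iff)
    show ?thesis
    proof (rule antisymmetrizer_kills_shared_row[of _ a y _ i])
      show "a \<in> row_set \<alpha> (\<pi> \<circ> t) i" "y \<in> row_set \<alpha> (\<pi> \<circ> t) i"
        unfolding y_def i(2) using i i' row_set_iff[OF pt] by auto
      show "a \<notin> row_set \<alpha> (\<pi> \<circ> t) j \<and> y \<notin> row_set \<alpha> (\<pi> \<circ> t) j" if "j \<noteq> i" for j
        unfolding y_def i(2) using i(1) i' row_set_iff[OF pt] that by auto
    qed (use finB yB aB in auto)
  qed
  have exp: "?f g = (\<Sum>\<pi>\<in>C t. fscale (of_int (sign \<pi>)) (fscale (of_int (sign g))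
        (tabloid_vec (\<lambda>j. g ` row_set \<alpha> (\<pi> \<circ> t) j))))" if g: "g permutes insert a ?B" for g
  proof -
    interpret l: Vector_Spaces.linear fscale fscale "perm_action g" by (rule lin_perm_action)
    have gp: "g permutes {1..n}" using permutes_subset[OF g sub] .
    have "e (g \<circ> t) = (\<Sum>\<pi>\<in>C t. fscale (of_int (sign \<pi>)) (tabloid_vec (\<lambda>j. g ` row_set \<alpha> (\<pi> \<circ> t) j)))"
      unfolding perm_action_polytabloid[OF gp, symmetric] polytabloid_def[of \<alpha> t] l.sum l.scale
        perm_action_tabloid_vec[OF permutes_bij[OF gp]] ..
    then have "?f g = (\<Sum>\<pi>\<in>C t. fscale (of_int (sign g) * of_int (sign \<pi>))
        (tabloid_vec (\<lambda>j. g ` row_set \<alpha> (\<pi> \<circ> t) j)))"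
      by (simp only: cfun.scale_sum_right cfun.scale_scale)
    then show ?thesis by (simp only: cfun.scale_scale mult.commute)
  qed
  have "(\<Sum>g | g permutes insert a ?B. ?f g) = 0"
  proof -
    have "(\<Sum>g | g permutes insert a ?B. ?f g) = (\<Sum>g | g permutes insert a ?B.
       \<Sum>\<pi>\<in>C t. fscale (of_int (sign \<pi>)) (fscale (of_int (sign g))
        (tabloid_vec (\<lambda>j. g ` row_set \<alpha> (\<pi> \<circ> t) j))))"
      using exp by (intro sum.cong refl) blast
    also have "\<dots> = (\<Sum>\<pi>\<in>C t. fscale (of_int (sign \<pi>)) (\<Sum>g | g permutes insert a ?B. fscale (of_int (sign g))
        (tabloid_vec (\<lambda>j. g ` row_set \<alpha> (\<pi> \<circ> t) j))))"
      unfolding cfun.scale_sum_right by (rule sum.swap)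
    also have "\<dots> = 0" by (intro sum.neutral ballI) (simp only: kill cfun.scale_zero_right)
    finally show ?thesis .
  qed
  moreover have "(\<Sum>g | g permutes insert a ?B. ?f g)
      = fscale (of_nat (card {q. q permutes ?B})) (e t - (\<Sum>b\<in>?B. e (transpose a b \<circ> t)))"
  proof -
    let ?N = "of_nat (card {q. q permutes ?B}) :: complex"
    have inner: "(\<Sum>q | q permutes ?B. ?f (transpose a b \<circ> q))
        = fscale ?N (fscale (of_int (sign (transpose a b))) (e (transpose a b \<circ> t)))"
      if b: "b \<in> insert a ?B" for b
    proof -
      have tb: "transpose a b permutes {1..n}"
        using b sub an by (intro permutes_swap_id) auto
      have "?f (transpose a b \<circ> q) = fscale (of_int (sign (transpose a b))) (e (transpose a b \<circ> t))"
        if q: "q permutes ?B" for q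
      proof -
        interpret l: Vector_Spaces.linear fscale fscale "perm_action (transpose a b)"
          by (rule lin_perm_action)
        have qC: "q \<in> C t" by (rule permutes_column_imp_stabilizer[OF t q])
        have qp: "q permutes {1..n}" by (rule column_stabilizer_permutes[OF qC])
        have "e (transpose a b \<circ> q \<circ> t) = perm_action (transpose a b) (e (q \<circ> t))"
          by (simp only: perm_action_polytabloid[OF tb] o_assoc)
        also have "\<dots> = fscale (of_int (sign q)) (e (transpose a b \<circ> t))"
          by (simp only: polytabloid_stabilizer[OF qC] l.scale perm_action_polytabloid[OF tb])
        finally have 1: "e (transpose a b \<circ> q \<circ> t) = fscale (of_int (sign q)) (e (transpose a b \<circ> t))" .
        have "sign (transpose a b \<circ> q) * sign q = sign (transpose a b)"
          using sign_compose_permutes[OF tb qp] by (simp add: sign_idempotent mult.assoc)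
        then have 2: "of_int (sign (transpose a b \<circ> q)) * of_int (sign q)
            = (of_int (sign (transpose a b)) :: complex)" by (metis of_int_mult)
        show ?thesis unfolding 1 cfun.scale_scale 2 ..
      qed
      then have "(\<Sum>q | q permutes ?B. ?f (transpose a b \<circ> q)) =
         (\<Sum>q | q permutes ?B. fscale (of_int (sign (transpose a b))) (e (transpose a b \<circ> t)))"
        by (intro sum.cong refl) blast
      then show ?thesis by (simp only: cfun.sum_constant_scale)
    qed
    have "(\<Sum>g | g permutes insert a ?B. ?f g)
      = (\<Sum>b\<in>insert a ?B. fscale ?N (fscale (of_int (sign (transpose a b))) (e (transpose a b \<circ> t))))"
      unfolding sum_over_permutations_insert[OF finB aB] using inner by (rule sum.cong[OF refl])
    also have "\<dots> = fscale ?N (e t) + (\<Sum>b\<in>?B. fscale ?N (- e (transpose a b \<circ> t)))"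
    proof -
      have "(\<Sum>b\<in>?B. fscale ?N (fscale (of_int (sign (transpose a b))) (e (transpose a b \<circ> t))))
         = (\<Sum>b\<in>?B. fscale ?N (- e (transpose a b \<circ> t)))"
      proof (intro sum.cong refl)
        fix b assume "b \<in> ?B"
        then have "a \<noteq> b" using aB by auto
        then show "fscale ?N (fscale (of_int (sign (transpose a b))) (e (transpose a b \<circ> t)))
           = fscale ?N (- e (transpose a b \<circ> t))"
          by (simp add: sign_swap_id)
      qed
      then show ?thesis using finB aB by (simp add: sign_id)
    qed
    also have "\<dots> = fscale ?N (e t - (\<Sum>b\<in>?B. e (transpose a b \<circ> t)))"
      by (simp add: cfun.scale_right_diff_distrib cfun.scale_sum_right sum_negf)
    finally show ?thesis .
  qed
  moreover have "card {q. q permutes ?B} \<noteq> 0"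
    using card_permutations[OF refl finB] by simp
  ultimately show ?thesis by (simp add: cfun.scale_eq_0_iff)
qed

section \<open>Tabloids and the support of Specht vectors\<close>

lemma subspace_specht: "cfun.subspace (specht \<alpha>)"
  unfolding specht_def by (rule cfun.subspace_span)

lemma polytabloid_in_specht: "tableau \<alpha> t \<Longrightarrow> e t \<in> specht \<alpha>"
  unfolding specht_def by (rule cfun.span_base) blast

lemma specht_minimal:
  assumes "cfun.subspace V" "\<And>t. tableau \<alpha> t \<Longrightarrow> e t \<in> V" shows "specht \<alpha> \<subseteq> V"
  unfolding specht_def using assms by (intro cfun.span_minimal) auto

lemma perm_action_specht:
  assumes "\<sigma> permutes {1..n}" "v \<in> specht \<alpha>" shows "perm_action \<sigma> v \<in> specht \<alpha>"
proof -
  interpret l: Vector_Spaces.linear fscale fscale "perm_action \<sigma>" by (rule lin_perm_action)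
  have "specht \<alpha> \<subseteq> {v. perm_action \<sigma> v \<in> specht \<alpha>}"
  proof (rule specht_minimal)
    show "cfun.subspace {v. perm_action \<sigma> v \<in> specht \<alpha>}"
      using l.subspace_vimage[OF subspace_specht] by (simp add: vimage_def)
    show "e t \<in> {v. perm_action \<sigma> v \<in> specht \<alpha>}" if "tableau \<alpha> t" for t
      using polytabloid_in_specht[OF tableau_comp[OF that assms(1)]]
      by (simp only: mem_Collect_eq perm_action_polytabloid[OF assms(1)])
  qed
  then show ?thesis using assms(2) by blast
qed

definition is_tabloid :: "(nat \<Rightarrow> nat set) \<Rightarrow> bool" where
  "is_tabloid T \<longleftrightarrow> (\<forall>i j. i \<noteq> j \<longrightarrow> T i \<inter> T j = {}) \<and> (\<Union>i. T i) = {1..n}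
     \<and> (\<forall>i. card (T i) = nat (\<alpha> i))"

lemma is_tabloid_row_set:
  assumes t: "tableau \<alpha> t" shows "is_tabloid (row_set \<alpha> t)"
proof -
  have "(\<Union>i. row_set \<alpha> t i) = t ` D" by (force simp: row_set_def)
  moreover have "t ` D = {1..n}" using t by (simp add: tableau_iff bij_betw_def)
  moreover have "row_set \<alpha> t i \<inter> row_set \<alpha> t j = {}" if "i \<noteq> j" for i j
    using that tableau_inj[OF t] by (fastforce simp: row_set_def)
  moreover have "card (row_set \<alpha> t i) = nat (\<alpha> i)" for i
  proof -
    have eq: "row_set \<alpha> t i = t ` Pair i ` {j. (i, j) \<in> D}" by (auto simp: row_set_def)
    have J: "{j. (i, j) \<in> D} = {1..nat (\<alpha> i)}"
      by (cases "i = 0") (auto simp: diagram_iff)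
    have "inj_on t (Pair i ` {j. (i, j) \<in> D})"
      by (rule inj_on_subset[of t D]) (use t in \<open>auto simp: tableau_iff bij_betw_def\<close>)
    then have "card (row_set \<alpha> t i) = card (Pair i ` {j. (i, j) \<in> D})"
      unfolding eq by (rule card_image)
    also have "\<dots> = card {j. (i, j) \<in> D}" by (rule card_image) (simp add: inj_on_def)
    finally show ?thesis by (simp add: J)
  qed
  ultimately show ?thesis by (simp add: is_tabloid_def)
qed

text \<open>
  The ambient space consists of functions of arbitrary sequences of sets; vectors of the Specht
  module vanish at sequences that are not tabloids of shape \<open>\<alpha>\<close>.
\<close>

lemma specht_support:
  assumes "v \<in> specht \<alpha>" "\<not> is_tabloid T" shows "v T = 0"
proof -
  have "specht \<alpha> \<subseteq> {v. v T = 0}"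
  proof (rule specht_minimal)
    show "cfun.subspace {v :: (nat \<Rightarrow> nat set) \<Rightarrow> complex. v T = 0}"
      by (auto simp: cfun.subspace_def fscale_def)
    show "e t \<in> {v. v T = 0}" if t: "tableau \<alpha> t" for t
    proof -
      have "T \<noteq> row_set \<alpha> (\<pi> \<circ> t)" if "\<pi> \<in> C t" for \<pi>
        using is_tabloid_row_set[OF tableau_comp[OF t column_stabilizer_permutes[OF that]]] assms(2) by auto
      then show ?thesis by (auto simp: polytabloid_apply intro!: sum.neutral)
    qed
  qed
  then show ?thesis using assms(1) by blast
qed

lemma finite_tabloids: "finite {T. is_tabloid T}"
proof (rule finite_subset)
  show "finite {f. \<forall>x. (x \<in> {..len \<alpha>} \<longrightarrow> f x \<in> Pow {1..n}) \<and> (x \<notin> {..len \<alpha>} \<longrightarrow> f x = {})}"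
    by (rule finite_set_of_finite_funs) auto
  have E: "T i = {}" if "is_tabloid T" "i > len \<alpha>" for T i
  proof -
    have "T i \<subseteq> {1..n}" using that by (auto simp: is_tabloid_def)
    then have "finite (T i)" by (rule finite_subset) simp
    moreover have "card (T i) = 0" using that Gam_uptoD[OF Gam_alpha that(2)] by (simp add: is_tabloid_def)
    ultimately show ?thesis by simp
  qed
  have S: "T i \<subseteq> {1..n}" if "is_tabloid T" for T i
    using that by (auto simp: is_tabloid_def)
  show "{T. is_tabloid T} \<subseteq> {f. \<forall>x. (x \<in> {..len \<alpha>} \<longrightarrow> f x \<in> Pow {1..n}) \<and> (x \<notin> {..len \<alpha>} \<longrightarrow> f x = {})}"
    using E S by (intro subsetI CollectI allI conjI impI PowI) (blast, simp add: not_le)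
qed

text \<open>
  There are finitely many tabloids, so this makes traces on \<open>S\<^sup>\<alpha>\<close> and its subspaces computable from
  finite bases.
\<close>

lemma specht_finite_dimensional: "specht \<alpha> \<subseteq> cfun.span (tabloid_vec ` {T. is_tabloid T})"
proof
  fix v assume v: "v \<in> specht \<alpha>"
  have "v = (\<Sum>T | is_tabloid T. fscale (v T) (tabloid_vec T))"
  proof
    fix U
    have "(\<Sum>T | is_tabloid T. fscale (v T) (tabloid_vec T)) U = (\<Sum>T | is_tabloid T. if T = U then v T else 0)"
      unfolding sum_fun_apply by (intro sum.cong) (auto simp: fscale_def tabloid_vec_def)
    also have "\<dots> = v U" using finite_tabloids specht_support[OF v, of U] by simp
    finally show "v U = (\<Sum>T | is_tabloid T. fscale (v T) (tabloid_vec T)) U" ..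
  qed
  also have "\<dots> \<in> cfun.span (tabloid_vec ` {T. is_tabloid T})"
    by (intro cfun.span_sum cfun.span_scale cfun.span_base) auto
  finally show "v \<in> cfun.span (tabloid_vec ` {T. is_tabloid T})" .
qed

section \<open>Linear equations satisfied by a Specht module\<close>

text \<open>
  The terms on the left are indexed by pairs of an entry \<open>x\<close> and a column permutation \<open>\<pi>\<close> such that
  \<open>\<pi> t\<close> represents \<open>U\<close> with \<open>x\<close> moved from row \<open>a\<close> to row \<open>b\<close>. In \<open>\<pi> t\<close> the cell of row \<open>a\<close> in the column of
  \<open>x\<close> contains some \<open>y\<close>, since row \<open>a\<close> is at least as long as row \<open>b\<close>. Exchanging \<open>x\<close> and \<open>y\<close> gives a column
  permutation of opposite sign, which represents \<open>U\<close> with \<open>y\<close> moved instead. This is an involution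
  without fixed points.
\<close>

lemma polytabloid_kernel_relation:
  assumes t: "tableau \<alpha> t" and ab: "1 \<le> a" "a < b" and U: "U a \<inter> U b = {}" "finite (U a)"
  shows "(\<Sum>x\<in>U a. e t (U(a := U a - {x}, b := insert x (U b)))) = 0"
proof -
  let ?M = "\<lambda>x. U(a := U a - {x}, b := insert x (U b))"
  let ?P = "{(x, \<pi>). x \<in> U a \<and> \<pi> \<in> C t \<and> ?M x = row_set \<alpha> (\<pi> \<circ> t)}"
  have finP: "finite ?P"
    by (rule finite_subset[of _ "U a \<times> C t"]) (use U(2) finite_column_stabilizer in auto)
  have "(\<Sum>x\<in>U a. e t (?M x)) = (\<Sum>x\<in>U a. \<Sum>\<pi>\<in>C t. if ?M x = row_set \<alpha> (\<pi> \<circ> t) then of_int (sign \<pi>) else 0)"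
    unfolding polytabloid_apply ..
  also have "\<dots> = (\<Sum>(x, \<pi>)\<in>U a \<times> C t. if ?M x = row_set \<alpha> (\<pi> \<circ> t) then of_int (sign \<pi>) else 0)"
    by (rule sum.cartesian_product)
  also have "\<dots> = (\<Sum>(x, \<pi>)\<in>?P. of_int (sign \<pi>))"
    by (rule sum.mono_neutral_cong_right) (use U(2) finite_column_stabilizer in \<open>auto split: if_splits\<close>)
  finally have eq: "(\<Sum>x\<in>U a. e t (?M x)) = (\<Sum>(x, \<pi>)\<in>?P. of_int (sign \<pi>))" .
  \<comment> \<open>The cell of \<open>x\<close> in \<open>\<pi> t\<close> is found by inverting \<open>\<pi> t\<close>; \<open>y\<close> is the entry of row \<open>a\<close> above it.\<close>
  define y where "y x \<pi> = \<pi> (t (a, snd (inv_into D (\<pi> \<circ> t) x)))" for x :: nat and \<pi> :: "nat \<Rightarrow> nat"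
  define f where "f = (\<lambda>(x, \<pi>). (y x \<pi>, transpose x (y x \<pi>) \<circ> \<pi>))"
  have key: "f (x, \<pi>) \<in> ?P \<and> f (f (x, \<pi>)) = (x, \<pi>) \<and> sign (snd (f (x, \<pi>))) = - sign \<pi>"
    if P: "(x, \<pi>) \<in> ?P" for x \<pi>
  proof -
    from P have x: "x \<in> U a" and p: "\<pi> \<in> C t" and M: "?M x = row_set \<alpha> (\<pi> \<circ> t)" by auto
    have pp: "\<pi> permutes {1..n}" by (rule column_stabilizer_permutes[OF p])
    have pt: "tableau \<alpha> (\<pi> \<circ> t)" by (rule tableau_comp[OF t pp])
    have "x \<in> row_set \<alpha> (\<pi> \<circ> t) b" using M[symmetric] by simp
    then obtain c where c: "(b, c) \<in> D" "x = \<pi> (t (b, c))" by (auto simp: row_set_def)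
    have ac: "(a, c) \<in> D" using diagram_down[OF c(1), of a c] ab c(1) by (simp add: diagram_iff)
    have invx: "inv_into D (\<pi> \<circ> t) x = (b, c)"
      using pt c by (intro inv_into_f_eq) (auto simp: tableau_iff bij_betw_def)
    have y: "y x \<pi> = \<pi> (t (a, c))" by (simp add: y_def invx)
    let ?y = "y x \<pi>" let ?s = "transpose x ?y" let ?p = "?s \<circ> \<pi>"
    have yx: "?y \<noteq> x" using tableau_inj[OF pt ac c(1)] ab by (simp add: y[symmetric] c(2)[symmetric])
    have ya: "?y \<in> row_set \<alpha> (\<pi> \<circ> t) i \<longleftrightarrow> i = a" for i
      using row_set_iff[OF pt ac, of i] by (auto simp: y[symmetric])
    have xb: "x \<in> row_set \<alpha> (\<pi> \<circ> t) i \<longleftrightarrow> i = b" for i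
      using row_set_iff[OF pt c(1), of i] by (auto simp: c(2)[symmetric])
    have "?y \<in> ?M x a" using ya[of a] M by metis
    then have yU: "?y \<in> U a" using ab by auto
    have "x \<in> \<pi> ` col_set \<alpha> t c" "?y \<in> \<pi> ` col_set \<alpha> t c"
      using imageI[OF col_setI[OF c(1), of t], of \<pi>] imageI[OF col_setI[OF ac, of t], of \<pi>]
      by (simp_all only: y[symmetric] c(2)[symmetric])
    then have xyc: "x \<in> col_set \<alpha> t c" "?y \<in> col_set \<alpha> t c"
      using p c(1) by (auto simp: column_stabilizer_iff diagram_iff)
    have sC: "?s \<in> C t" by (rule transpose_in_stabilizer[OF t xyc])
    have sp: "?s permutes {1..n}" by (rule column_stabilizer_permutes[OF sC])
    have pC: "?p \<in> C t" by (rule stabilizer_comp[OF sC p])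
    have ptt: "tableau \<alpha> (?p \<circ> t)" by (rule tableau_comp[OF t column_stabilizer_permutes[OF pC]])
    have xU: "x \<notin> U b" "?y \<notin> U b" using x yU U(1) by auto
    have rows: "?M ?y = row_set \<alpha> (?p \<circ> t)"
    proof
      fix i
      have "row_set \<alpha> (?p \<circ> t) i = ?s ` ?M x i"
        unfolding M o_assoc[symmetric] row_set_comp[of \<alpha> ?s "\<pi> \<circ> t"] ..
      also have "\<dots> = ?M ?y i"
      proof -
        consider "i = a" | "i = b" | "i \<noteq> a" "i \<noteq> b" by blast
        then show ?thesis
        proof cases
          case 1
          then show ?thesis using ab x yU yx by (auto simp: transpose_def image_iff)
        next
          case 2
          then show ?thesis using ab xU yx by (auto simp: transpose_def image_iff)
        next
          case 3
          then have "x \<notin> U i" "?y \<notin> U i" using xb[of i] ya[of i] M[symmetric] by auto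
          then have "?s ` U i = U i" by (auto simp: transpose_def image_iff)
          with 3 show ?thesis by simp
        qed
      qed
      finally show "?M ?y i = row_set \<alpha> (?p \<circ> t) i" ..
    qed
    have "?p (t (b, c)) = ?y" using c(2) by simp
    then have "inv_into D (?p \<circ> t) ?y = (b, c)"
      using ptt c by (intro inv_into_f_eq) (auto simp: tableau_iff bij_betw_def)
    then have yy: "y ?y ?p = x" using y by (simp add: y_def)
    have "f (?y, ?p) = (x, \<pi>)"
      unfolding f_def by (simp add: yy o_assoc transpose_commute[of ?y x])
    moreover have "sign ?p = - sign \<pi>"
      using sign_compose_permutes[OF sp pp] yx by (simp add: sign_swap_id)
    moreover have "f (x, \<pi>) = (?y, ?p)" by (simp add: f_def)
    ultimately show ?thesis using yU pC rows by (metis (mono_tags, lifting) case_prodI mem_Collect_eq snd_conv)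
  qed
  have "(\<Sum>z\<in>?P. of_int (sign (snd z))) = (\<Sum>z\<in>?P. - (of_int (sign (snd z)) :: complex))"
  proof (rule sum.reindex_bij_witness[of _ f f])
    fix z assume z: "z \<in> ?P"
    obtain x \<pi> where [simp]: "z = (x, \<pi>)" by (cases z)
    note k = key[OF z[simplified \<open>z = (x, \<pi>)\<close>]]
    show "f (f z) = z" "f z \<in> ?P" "f (f z) = z" "f z \<in> ?P" using k by (simp_all)
    show "- of_int (sign (snd (f z))) = (of_int (sign (snd z)) :: complex)" using k by simp
  qed
  also have "\<dots> = - (\<Sum>z\<in>?P. of_int (sign (snd z)))" by (rule sum_negf)
  finally have "(\<Sum>z\<in>?P. of_int (sign (snd z)) :: complex) = 0" by (rule eq_uminus_imp_zero)
  then show ?thesis unfolding eq by (simp add: case_prod_unfold)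
qed

text \<open>
  These equations express that \<open>S\<^sup>\<alpha>\<close> is killed by the maps that move one entry to a higher row. For
  \<open>U\<close> obtained from a tabloid by moving the largest entry \<open>n\<close> up from row \<open>b\<close>, they evaluate the sum over
  the exchanges of \<open>n\<close> with the entries of row \<open>a\<close>.
\<close>

lemma specht_kernel_relation:
  assumes "v \<in> specht \<alpha>" and ab: "1 \<le> a" "a < b" and U: "U a \<inter> U b = {}" "finite (U a)"
  shows "(\<Sum>x\<in>U a. v (U(a := U a - {x}, b := insert x (U b)))) = 0"
proof -
  let ?M = "\<lambda>x. U(a := U a - {x}, b := insert x (U b))"
  have "specht \<alpha> \<subseteq> {v. (\<Sum>x\<in>U a. v (?M x)) = 0}"
  proof (rule specht_minimal)
    show "cfun.subspace {v :: (nat \<Rightarrow> nat set) \<Rightarrow> complex. (\<Sum>x\<in>U a. v (?M x)) = 0}"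
      unfolding cfun.subspace_def fscale_def
      by (simp only: mem_Collect_eq plus_fun_apply zero_fun_apply sum.distrib sum_distrib_left[symmetric]
            sum.neutral_const) simp
    show "e t \<in> {v. (\<Sum>x\<in>U a. v (?M x)) = 0}" if "tableau \<alpha> t" for t
      by (rule CollectI) (rule polytabloid_kernel_relation[OF that ab U])
  qed
  with assms(1) show ?thesis by blast
qed

end

section \<open>The Jucys-Murphy element\<close>

definition jucys_murphy :: "nat \<Rightarrow> ((nat \<Rightarrow> nat set) \<Rightarrow> complex) \<Rightarrow> (nat \<Rightarrow> nat set) \<Rightarrow> complex" where
  "jucys_murphy n v = (\<Sum>k = 1..<n. perm_action (transpose k n) v)"

lemma jucys_murphy_apply:
  "jucys_murphy n v T = (\<Sum>k = 1..<n. v (\<lambda>i. transpose k n ` T i))"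
  by (simp add: jucys_murphy_def sum_fun_apply perm_action_def)

lemma lin_jucys_murphy: "lin (jucys_murphy n)"
  by (rule linI) (simp_all add: fun_eq_iff jucys_murphy_apply sum.distrib fscale_def sum_distrib_left)

context partition_shape
begin

lemma transpose_permutes: "k \<in> {1..<n} \<Longrightarrow> transpose k n permutes {1..n}"
  by (intro permutes_swap_id) auto

lemma jucys_murphy_specht: "v \<in> specht \<alpha> \<Longrightarrow> jucys_murphy n v \<in> specht \<alpha>"
  unfolding jucys_murphy_def
  by (intro cfun.subspace_sum subspace_specht perm_action_specht transpose_permutes)

section \<open>Filtration by the lowest row containing the largest entry\<close>

definition row_filtration :: "nat \<Rightarrow> ((nat \<Rightarrow> nat set) \<Rightarrow> complex) set" where
  "row_filtration s = {v \<in> specht \<alpha>. \<forall>T i. s < i \<longrightarrow> n \<in> T i \<longrightarrow> v T = 0}"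

text \<open>
  The content of the last box of row \<open>s\<close>, which is where \<open>n\<close> is removed.
\<close>

definition content :: "nat \<Rightarrow> complex" where
  "content s = of_int (\<alpha> s - int s)"

lemma subspace_row_filtration: "cfun.subspace (row_filtration s)"
  using subspace_specht by (auto simp: cfun.subspace_def row_filtration_def fscale_def)

lemma row_filtration_vanishes: "v \<in> row_filtration s \<Longrightarrow> s < i \<Longrightarrow> n \<in> T i \<Longrightarrow> v T = 0"
  unfolding row_filtration_def by blast

lemma row_filtration_mono: "s \<le> s' \<Longrightarrow> row_filtration s \<subseteq> row_filtration s'"
  unfolding row_filtration_def by (blast intro: le_less_trans)

lemma row_filtration_specht: "row_filtration s \<subseteq> specht \<alpha>"
  by (auto simp: row_filtration_def)

text \<open>
  Row 0 and the rows beyond \<open>len \<alpha>\<close> are empty because their prescribed size is 0.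
\<close>

lemma tabloid_row_bounds:
  assumes "is_tabloid T" "x \<in> T i" shows "1 \<le> i" "i \<le> len \<alpha>" "x \<in> {1..n}"
proof -
  have sub: "T i \<subseteq> {1..n}" using assms(1) by (auto simp: is_tabloid_def)
  then have fin: "finite (T i)" by (rule finite_subset) simp
  have "card (T i) = nat (\<alpha> i)" using assms(1) by (simp add: is_tabloid_def)
  then have ne: "\<alpha> i \<noteq> 0" using fin assms(2) by auto
  then show "1 \<le> i" by (cases i) auto
  show "i \<le> len \<alpha>" using ne Gam_uptoD[OF Gam_alpha] by (meson not_le)
  show "x \<in> {1..n}" using sub assms(2) by blast
qed

lemma row_filtration_len: "row_filtration (len \<alpha>) = specht \<alpha>"
proof -
  have "v T = 0" if "v \<in> specht \<alpha>" "len \<alpha> < i" "n \<in> T i" for v T i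
    using specht_support[OF that(1), of T] tabloid_row_bounds(2)[of T n i] that by force
  then show ?thesis by (auto simp: row_filtration_def)
qed

lemma row_filtration_0:
  assumes "n > 0" shows "row_filtration 0 = {0}"
proof -
  have "v = 0" if v: "v \<in> row_filtration 0" for v
  proof
    fix T
    show "v T = 0 T"
    proof (cases "is_tabloid T")
      case True
      have "n \<in> (\<Union>i. T i)" using True assms by (simp add: is_tabloid_def)
      then obtain i where "n \<in> T i" by blast
      then show ?thesis using row_filtration_vanishes[OF v, of i T] tabloid_row_bounds(1)[OF True, of n i] by simp
    next
      case False
      then show ?thesis using v specht_support by (auto simp: row_filtration_def)
    qed
  qed
  then show ?thesis using cfun.subspace_0[OF subspace_row_filtration] by auto
qed

text \<open>
  Sum over the rows \<open>u\<close> of the entries \<open>k\<close> exchanged with \<open>n\<close>. The \<open>\<alpha> s - 1\<close> entries of row \<open>s\<close> do not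
  change the tabloid. Each of the \<open>s - 1\<close> rows above contributes \<open>- v T\<close> by the kernel relation. The
  rows below contribute nothing, since \<open>v\<close> vanishes where \<open>n\<close> lies below row \<open>r\<close>. The case \<open>r < s\<close>, in
  which both sides are 0, shows that the filtration is stable.
\<close>

lemma jucys_murphy_value:
  assumes v: "v \<in> row_filtration r" and T: "is_tabloid T" and nT: "n \<in> T s" and rs: "r \<le> s"
  shows "jucys_murphy n v T = content s * v T"
proof -
  have vS: "v \<in> specht \<alpha>" using v row_filtration_specht by blast
  note s = tabloid_row_bounds[OF T nT]
  have dis: "T i \<inter> T j = {}" if "i \<noteq> j" for i j using T that by (auto simp: is_tabloid_def)
  have n_only: "n \<in> T i \<longleftrightarrow> i = s" for i using dis nT by blast
  have sub: "T i \<subseteq> {1..n}" for i using tabloid_row_bounds(3)[OF T] by blast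
  have fin: "finite (T i)" for i using sub finite_subset by blast
  let ?w = "\<lambda>k. v (\<lambda>i. transpose k n ` T i)"
  have cover: "{1..<n} = (\<Union>u\<in>{1..len \<alpha>}. T u - {n})"
  proof
    show "{1..<n} \<subseteq> (\<Union>u\<in>{1..len \<alpha>}. T u - {n})"
    proof
      fix k assume k: "k \<in> {1..<n}"
      then have "k \<in> (\<Union>i. T i)" using T by (auto simp: is_tabloid_def)
      then obtain u where "k \<in> T u" by blast
      then show "k \<in> (\<Union>u\<in>{1..len \<alpha>}. T u - {n})" using tabloid_row_bounds[OF T] k by force
    qed
    show "(\<Union>u\<in>{1..len \<alpha>}. T u - {n}) \<subseteq> {1..<n}" using sub by force
  qed
  have row_sum: "(\<Sum>k\<in>T u - {n}. ?w k)
     = (if u = s then of_int (\<alpha> s - 1) * v T else 0) + (if u < s then - v T else 0)"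
    if u: "u \<in> {1..len \<alpha>}" for u
  proof -
    consider "u = s" | "u < s" | "u > s" by linarith
    then show ?thesis
    proof cases
      case 1
      have "?w k = v T" if k: "k \<in> T s - {n}" for k
      proof -
        have "transpose k n ` T i = T i" for i
          using dis[of i s] nT k by (cases "i = s") (auto simp: transpose_def image_iff)
        then show ?thesis by simp
      qed
      moreover have "card (T s - {n}) = nat (\<alpha> s) - 1"
        using T nT fin by (simp add: is_tabloid_def)
      moreover have "\<alpha> s \<ge> 1"
        using T nT fin[of s] alpha_nonneg[of s] by (cases "\<alpha> s = 0") (auto simp: is_tabloid_def dest: spec[of _ s])
      ultimately show ?thesis using 1 by (simp add: nat_diff_distrib' of_nat_diff)
    next
      case 2
      \<comment> \<open>Row \<open>u\<close> of \<open>U\<close> has one entry too many, among them \<open>n\<close>. Moving \<open>n\<close> back to row \<open>s\<close> restores \<open>T\<close>, and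
        moving another entry \<open>k\<close> instead exchanges \<open>k\<close> and \<open>n\<close>.\<close>
      let ?U = "T(s := T s - {n}, u := insert n (T u))"
      have nu: "n \<notin> T u" using n_only 2 by simp
      have "(\<Sum>x\<in>?U u. v (?U(u := ?U u - {x}, s := insert x (?U s)))) = 0"
        using u 2 dis[of u s] fin by (intro specht_kernel_relation[OF vS]) auto
      moreover have swap: "?U(u := ?U u - {x}, s := insert x (?U s)) = (\<lambda>i. transpose x n ` T i)"
        if x: "x \<in> insert n (T u)" for x
      proof
        fix i
        consider "i = s" | "i = u" | "i \<noteq> s" "i \<noteq> u" by blast
        then show "(?U(u := ?U u - {x}, s := insert x (?U s))) i = transpose x n ` T i"
        proof cases
          case a: 1
          show ?thesis using a 2 x nT dis[of u s] by (auto simp: transpose_def image_iff)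
        next
          case b: 2
          show ?thesis using b 2 x nu by (auto simp: transpose_def image_iff)
        next
          case c: 3
          then have "n \<notin> T i" "x \<notin> T i" using n_only x dis[of i u] by auto
          then have "transpose x n ` T i = T i" by (auto simp: transpose_def image_iff)
          then show ?thesis using c by simp
        qed
      qed
      moreover have "?U u = insert n (T u)" by simp
      ultimately have "(\<Sum>x\<in>insert n (T u). ?w x) = 0"
        using sum.cong[OF refl, of "insert n (T u)" "\<lambda>x. v (?U(u := ?U u - {x}, s := insert x (?U s)))" ?w]
        by simp
      then have "v T + (\<Sum>x\<in>T u. ?w x) = 0" using fin nu by simp
      then have "(\<Sum>x\<in>T u. ?w x) = - v T" by (simp add: eq_neg_iff_add_eq_0 add.commute)
      then show ?thesis using 2 nu by simp
    next
      case 3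
      have "?w k = 0" if k: "k \<in> T u - {n}" for k
      proof -
        have "n \<in> transpose k n ` T u" using k by (auto simp: image_iff intro!: bexI[of _ k])
        then show ?thesis using 3 rs by (intro row_filtration_vanishes[OF v, of u]) auto
      qed
      then show ?thesis using 3 by simp
    qed
  qed
  have "jucys_murphy n v T = (\<Sum>u\<in>{1..len \<alpha>}. \<Sum>k\<in>T u - {n}. ?w k)"
    unfolding jucys_murphy_apply cover by (rule sum.UNION_disjoint) (use fin dis in blast)+
  also have "\<dots> = (\<Sum>u\<in>{1..len \<alpha>}. (if u = s then of_int (\<alpha> s - 1) * v T else 0) + (if u < s then - v T else 0))"
    using row_sum by (rule sum.cong[OF refl])
  also have "\<dots> = of_int (\<alpha> s - 1) * v T + (\<Sum>u\<in>{1..len \<alpha>}. if u < s then - v T else 0)"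
    unfolding sum.distrib using s by simp
  also have "(\<Sum>u\<in>{1..len \<alpha>}. if u < s then - v T else 0) = (\<Sum>u\<in>{1..<s}. - v T)"
    using s by (intro sum.mono_neutral_cong_right) auto
  also have "of_int (\<alpha> s - 1) * v T + (\<Sum>u\<in>{1..<s}. - v T) = content s * v T"
    using s(1) by (simp add: content_def of_nat_diff algebra_simps)
  finally show ?thesis .
qed

lemma jucys_murphy_row_filtration:
  assumes v: "v \<in> row_filtration s" and s: "1 \<le> s"
  shows "jucys_murphy n v - fscale (content s) v \<in> row_filtration (s - 1)"
proof -
  have vS: "v \<in> specht \<alpha>" using v row_filtration_specht by blast
  have "jucys_murphy n v - fscale (content s) v \<in> specht \<alpha>"
    by (intro cfun.subspace_diff cfun.subspace_scale subspace_specht jucys_murphy_specht vS)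
  moreover have "(jucys_murphy n v - fscale (content s) v) T = 0" if "s - 1 < i" "n \<in> T i" for T i
  proof (cases "is_tabloid T")
    case True
    have "jucys_murphy n v T = content i * v T"
      using jucys_murphy_value[OF v True that(2)] that(1) by simp
    moreover have "v T = 0" if "i \<noteq> s"
      using row_filtration_vanishes[OF v, of i T] \<open>s - 1 < i\<close> \<open>n \<in> T i\<close> that by simp
    ultimately show ?thesis by (cases "i = s") (auto simp: fscale_def)
  next
    case False
    then show ?thesis
      using specht_support[OF vS] specht_support[OF jucys_murphy_specht[OF vS]] by (simp add: fscale_def)
  qed
  ultimately show ?thesis by (simp add: row_filtration_def)
qed

lemma jucys_murphy_row_filtration_stable:
  assumes "v \<in> row_filtration s" "1 \<le> s" shows "jucys_murphy n v \<in> row_filtration s"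
proof -
  have "jucys_murphy n v - fscale (content s) v \<in> row_filtration s"
    using jucys_murphy_row_filtration[OF assms] row_filtration_mono[of "s - 1" s] by auto
  then have "(jucys_murphy n v - fscale (content s) v) + fscale (content s) v \<in> row_filtration s"
    using assms(1) by (intro cfun.subspace_add cfun.subspace_scale subspace_row_filtration)
  then show ?thesis by simp
qed

section \<open>Polytabloids with the largest entry in a corner\<close>

text \<open>
  The indices \<open>r\<close> for which \<open>\<alpha> - eps r\<close> is a partition.
\<close>

definition corner :: "nat \<Rightarrow> bool" where
  "corner r \<longleftrightarrow> 1 \<le> r \<and> \<alpha> (r + 1) < \<alpha> r"

definition corner_span :: "nat \<Rightarrow> ((nat \<Rightarrow> nat set) \<Rightarrow> complex) set" where
  "corner_span s = cfun.span {e t | t r. tableau \<alpha> t \<and> corner r \<and> r \<le> s \<and> t (r, nat (\<alpha> r)) = n}"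

lemma subspace_corner_span: "cfun.subspace (corner_span s)"
  unfolding corner_span_def by (rule cfun.subspace_span)

lemma corner_span_mono: "s \<le> s' \<Longrightarrow> corner_span s \<subseteq> corner_span s'"
  unfolding corner_span_def by (rule cfun.span_mono) force

lemma corner_span_base: "tableau \<alpha> t \<Longrightarrow> corner r \<Longrightarrow> r \<le> s \<Longrightarrow> t (r, nat (\<alpha> r)) = n \<Longrightarrow> e t \<in> corner_span s"
  unfolding corner_span_def by (rule cfun.span_base) blast

lemma corner_span_minimal:
  assumes "cfun.subspace V"
    and "\<And>t r. tableau \<alpha> t \<Longrightarrow> corner r \<Longrightarrow> r \<le> s \<Longrightarrow> t (r, nat (\<alpha> r)) = n \<Longrightarrow> e t \<in> V"
  shows "corner_span s \<subseteq> V"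
  unfolding corner_span_def using assms by (intro cfun.span_minimal) auto

lemma corner_diagram:
  assumes "corner r"
  shows "(r, nat (\<alpha> r)) \<in> D" "int (nat (\<alpha> r)) = \<alpha> r"
    "(i, nat (\<alpha> r)) \<in> D \<longleftrightarrow> 1 \<le> i \<and> i \<le> r"
proof -
  have pos: "1 \<le> r" "\<alpha> r > 0" using assms alpha_nonneg[of "r + 1"] by (auto simp: corner_def)
  then show eq: "int (nat (\<alpha> r)) = \<alpha> r" and D: "(r, nat (\<alpha> r)) \<in> D" by (auto simp: diagram_iff)
  show "(i, nat (\<alpha> r)) \<in> D \<longleftrightarrow> 1 \<le> i \<and> i \<le> r"
  proof
    assume i: "(i, nat (\<alpha> r)) \<in> D"
    have "i \<le> r"
    proof (rule ccontr)
      assume "\<not> i \<le> r"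
      then have "\<alpha> i \<le> \<alpha> (r + 1)" by (intro alpha_antimono) auto
      then show False using i assms pos by (auto simp: diagram_iff corner_def)
    qed
    then show "1 \<le> i \<and> i \<le> r" using i by (simp add: diagram_iff)
  next
    assume "1 \<le> i \<and> i \<le> r"
    then show "(i, nat (\<alpha> r)) \<in> D" using diagram_down[OF D, of i "nat (\<alpha> r)"] pos by auto
  qed
qed

text \<open>
  The largest entry \<open>n\<close> can be moved to a corner. If the bottom cell of its column is the end of a
  row, a column transposition puts \<open>n\<close> there. Otherwise the next column has the same length, and the
  Garnir relation writes \<open>e t\<close> in terms of tableaux with \<open>n\<close> in the next column.
\<close>

lemma polytabloid_in_corner_span:
  assumes "tableau \<alpha> t" "n \<in> col_set \<alpha> t c" "\<And>i. (i, c) \<in> D \<Longrightarrow> i \<le> s"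
  shows "e t \<in> corner_span s"
  using assms
proof (induction "nat (\<alpha> 1) - c" arbitrary: t c rule: less_induct)
  case less
  note t = less.prems(1)
  obtain i0 where i0: "(i0, c) \<in> D" "t (i0, c) = n" using less.prems(2) by (auto simp: col_set_def)
  have c1: "1 \<le> c" using i0 by (simp add: diagram_iff)
  let ?I = "{i. (i, c) \<in> D}"
  have finI: "finite ?I" by (rule finite_subset[of _ "{..len \<alpha>}"]) (use diagram_row_le in auto)
  define r where "r = Max ?I"
  have r: "(r, c) \<in> D" and rmax: "\<And>i. (i, c) \<in> D \<Longrightarrow> i \<le> r"
    using Max_in[OF finI] Max_ge[OF finI] i0 by (auto simp: r_def)
  have rc: "1 \<le> r" "int c \<le> \<alpha> r" using r by (auto simp: diagram_iff)
  show ?case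
  proof (cases "int c = \<alpha> r")
    case True
    have "(r + 1, c) \<notin> D" using rmax[of "r + 1"] by auto
    then have corner: "corner r" using True rc c1 by (auto simp: corner_def diagram_iff)
    define x where "x = t (r, c)"
    have q: "transpose n x \<in> C t"
      unfolding x_def by (rule transpose_in_stabilizer[OF t less.prems(2) col_setI[OF r]])
    let ?t = "transpose n x \<circ> t"
    have "e ?t \<in> corner_span s"
    proof (rule corner_span_base[of _ r])
      show "tableau \<alpha> ?t" by (rule tableau_comp[OF t column_stabilizer_permutes[OF q]])
      show "r \<le> s" by (rule less.prems(3)[OF r])
      show "?t (r, nat (\<alpha> r)) = n" using True by (simp add: x_def True[symmetric])
    qed (rule corner)
    moreover have "e t = fscale (of_int (sign (transpose n x))) (e ?t)"
    proof -
      have "of_int (sign (transpose n x)) * of_int (sign (transpose n x)) = (1 :: complex)"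
        by (metis of_int_1 of_int_mult sign_idempotent)
      then show ?thesis by (simp add: polytabloid_stabilizer[OF q])
    qed
    ultimately show ?thesis by (metis cfun.subspace_scale subspace_corner_span)
  next
    case False
    then have less_r: "int c < \<alpha> r" using rc by simp
    have next_col: "(i, c + 1) \<in> D" if "(i, c) \<in> D" for i
      using rmax[OF that] that less_r alpha_antimono[of i r] by (auto simp: diagram_iff)
    have "e t = (\<Sum>b\<in>col_set \<alpha> t (c + 1). e (transpose n b \<circ> t))"
      using c1 next_col less.prems(2) by (intro garnir_one_cell[OF t, of c]) auto
    also have "\<dots> \<in> corner_span s"
    proof (intro cfun.subspace_sum subspace_corner_span)
      fix b assume b: "b \<in> col_set \<alpha> t (c + 1)"
      have n: "n \<in> {1..n}" using less.prems(2) col_set_subset[OF t] by blast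
      have "transpose n b permutes {1..n}"
        using n b col_set_subset[OF t] by (intro permutes_swap_id) blast+
      then have tt: "tableau \<alpha> (transpose n b \<circ> t)" by (rule tableau_comp[OF t])
      have "transpose n b b \<in> col_set \<alpha> (transpose n b \<circ> t) (c + 1)"
        unfolding col_set_comp using b by (rule imageI)
      then have nc: "n \<in> col_set \<alpha> (transpose n b \<circ> t) (c + 1)" by simp
      have "c + 1 \<le> nat (\<alpha> 1)" using diagram_col_le[OF next_col[OF r]] .
      then have "nat (\<alpha> 1) - (c + 1) < nat (\<alpha> 1) - c" by simp
      moreover have "i \<le> s" if "(i, c + 1) \<in> D" for i
        using less.prems(3)[of i] diagram_down[OF that, of i c] that c1 by (auto simp: diagram_iff)
      ultimately show "e (transpose n b \<circ> t) \<in> corner_span s" using less.hyps tt nc by blast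
    qed
    finally show ?thesis .
  qed
qed

lemma specht_eq_corner_span:
  assumes "n > 0" shows "specht \<alpha> = corner_span (len \<alpha>)"
proof
  show "specht \<alpha> \<subseteq> corner_span (len \<alpha>)"
  proof (rule specht_minimal[OF subspace_corner_span])
    fix t assume t: "tableau \<alpha> t"
    obtain i j where "(i, j) \<in> D" "t (i, j) = n"
      using tableau_surj[OF t, of n] assms by auto
    then have "n \<in> col_set \<alpha> t j" using col_setI by metis
    then show "e t \<in> corner_span (len \<alpha>)" using polytabloid_in_corner_span[OF t] diagram_row_le by blast
  qed
  show "corner_span (len \<alpha>) \<subseteq> specht \<alpha>"
    by (rule corner_span_minimal[OF subspace_specht]) (rule polytabloid_in_specht)
qed

lemma corner_span_subset_row_filtration: "corner_span s \<subseteq> row_filtration s"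
proof (rule corner_span_minimal[OF subspace_row_filtration])
  fix t r assume t: "tableau \<alpha> t" and r: "corner r" "r \<le> s" "t (r, nat (\<alpha> r)) = n"
  have "e t T = 0" if i: "s < i" "n \<in> T i" for T i
  proof -
    have "T \<noteq> row_set \<alpha> (\<pi> \<circ> t)" if p: "\<pi> \<in> C t" for \<pi>
    proof
      assume "T = row_set \<alpha> (\<pi> \<circ> t)"
      then obtain j where j: "(i, j) \<in> D" "n = \<pi> (t (i, j))" using i(2) by (auto simp: row_set_def)
      have "j = nat (\<alpha> r)"
        using stabilizer_column[OF t p j(1) corner_diagram(1)[OF r(1)]] j(2) r(3) by simp
      then show False using corner_diagram(3)[OF r(1), of i] j(1) r(2) i(1) by simp
    qed
    then show ?thesis by (auto simp: polytabloid_apply intro!: sum.neutral)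
  qed
  then show "e t \<in> row_filtration s" using polytabloid_in_specht[OF t] by (simp add: row_filtration_def)
qed

text \<open>
  For \<open>n\<close> in the corner of row \<open>r\<close>, let \<open>c = \<alpha> r\<close> be its column. Exchanging \<open>n\<close> with the other \<open>r - 1\<close>
  entries of column \<open>c\<close> gives \<open>- e t\<close> each. Exchanging it with all entries of a column to the left gives
  \<open>e t\<close> in total, by the Garnir relation; there are \<open>c - 1\<close> of these. The difference is the content
  \<open>c - r\<close>. Exchanges with entries to the right put \<open>n\<close> into a column that ends above row \<open>r\<close>.
\<close>

lemma jucys_murphy_corner_polytabloid:
  assumes t: "tableau \<alpha> t" and r: "corner r" and tn: "t (r, nat (\<alpha> r)) = n"
  shows "jucys_murphy n (e t) - fscale (content r) (e t) \<in> corner_span (r - 1)"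
proof -
  define c where "c = nat (\<alpha> r)"
  note cd = corner_diagram[OF r, folded c_def]
  have c1: "1 \<le> c" and r1: "1 \<le> r" using cd(1) by (auto simp: diagram_iff)
  have ncol: "n \<in> col_set \<alpha> t j \<longleftrightarrow> j = c" for j
    using col_set_iff[OF t cd(1), of j] tn by (auto simp: c_def)
  have n1: "n \<in> {1..n}" using tableau_in[OF t cd(1)] tn by (simp add: c_def)
  let ?g = "\<lambda>k. e (transpose k n \<circ> t)"
  let ?M = "nat (\<alpha> 1)"
  have cM: "c \<le> ?M" using diagram_col_le[OF cd(1)] .
  define S where "S j = (\<Sum>k\<in>col_set \<alpha> t j - {n}. ?g k)" for j
  have cover: "{1..<n} = (\<Union>j\<in>{1..?M}. col_set \<alpha> t j - {n})"
  proof
    show "{1..<n} \<subseteq> (\<Union>j\<in>{1..?M}. col_set \<alpha> t j - {n})"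
    proof
      fix k assume k: "k \<in> {1..<n}"
      then obtain i j where ij: "(i, j) \<in> D" "t (i, j) = k" using tableau_surj[OF t, of k] by auto
      then have "k \<in> col_set \<alpha> t j - {n}" "j \<in> {1..?M}"
        using col_setI[OF ij(1), of t] k diagram_col_le[OF ij(1)] by (auto simp: diagram_iff)
      then show "k \<in> (\<Union>j\<in>{1..?M}. col_set \<alpha> t j - {n})" by blast
    qed
    show "(\<Union>j\<in>{1..?M}. col_set \<alpha> t j - {n}) \<subseteq> {1..<n}" using col_set_subset[OF t] by force
  qed
  have "jucys_murphy n (e t) = (\<Sum>k\<in>{1..<n}. ?g k)"
    unfolding jucys_murphy_def using transpose_permutes perm_action_polytabloid by (intro sum.cong refl) blast
  also have "\<dots> = (\<Sum>j\<in>{1..?M}. S j)"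
    unfolding cover S_def using finite_col_set[OF t] col_set_disjoint[OF t]
    by (intro sum.UNION_disjoint) auto
  also have "{1..?M} = {1..<c} \<union> {c} \<union> {c<..?M}" using c1 cM by auto
  also have "sum S \<dots> = sum S {1..<c} + S c + sum S {c<..?M}"
    by (subst sum.union_disjoint; (subst sum.union_disjoint)?) auto
  also have "sum S {1..<c} = fscale (of_nat (c - 1)) (e t)"
  proof -
    have "S j = e t" if j: "j \<in> {1..<c}" for j
    proof -
      have "e t = (\<Sum>b\<in>col_set \<alpha> t j. e (transpose n b \<circ> t))"
        using j c1 ncol diagram_down by (intro garnir_one_cell[OF t, of c]) (auto simp: diagram_iff)
      then show ?thesis using j ncol[of j] by (simp add: S_def transpose_commute[of n])
    qed
    then have "sum S {1..<c} = (\<Sum>j\<in>{1..<c}. e t)" by (intro sum.cong) auto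
    then show ?thesis by (simp only: cfun.sum_constant_scale card_atLeastLessThan)
  qed
  also have "S c = fscale (- of_nat (r - 1)) (e t)"
  proof -
    have "?g k = - e t" if k: "k \<in> col_set \<alpha> t c - {n}" for k
      using polytabloid_stabilizer[OF transpose_in_stabilizer[OF t, of k c n]] k ncol
      by (simp add: sign_swap_id)
    then have "S c = (\<Sum>k\<in>col_set \<alpha> t c - {n}. - e t)" unfolding S_def by (intro sum.cong) auto
    moreover have "card (col_set \<alpha> t c - {n}) = r - 1"
    proof -
      have eq: "col_set \<alpha> t c = t ` (\<lambda>i. (i, c)) ` {1..r}" using cd(3) by (auto simp: col_set_def)
      have "inj_on t ((\<lambda>i. (i, c)) ` {1..r})"
        by (rule inj_on_subset[of t D]) (use t cd(3) in \<open>auto simp: tableau_iff bij_betw_def\<close>)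
      then have "card (col_set \<alpha> t c) = card ((\<lambda>i. (i, c)) ` {1..r})" unfolding eq by (rule card_image)
      also have "\<dots> = card {1..r}" by (rule card_image) (simp add: inj_on_def)
      finally have "card (col_set \<alpha> t c) = r" by simp
      then show ?thesis using ncol[of c] finite_col_set[OF t] by simp
    qed
    ultimately have "S c = fscale (of_nat (r - 1)) (- e t)" by (simp only: cfun.sum_constant_scale)
    then show ?thesis by simp
  qed
  finally have jm: "jucys_murphy n (e t)
     = fscale (of_nat (c - 1)) (e t) + fscale (- of_nat (r - 1)) (e t) + sum S {c<..?M}" .
  have "content r = of_nat (c - 1) + - of_nat (r - 1)"
  proof -
    have "content r = of_int (int c) - of_int (int r)" unfolding content_def cd(2) by simp
    then show ?thesis using c1 r1 by (simp add: of_nat_diff)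
  qed
  then have "jucys_murphy n (e t) - fscale (content r) (e t) = sum S {c<..?M}"
    unfolding jm by (simp add: cfun.scale_left_distrib cfun.scale_left_diff_distrib)
  also have "\<dots> \<in> corner_span (r - 1)"
  proof (rule cfun.subspace_sum[OF subspace_corner_span])
    fix j assume j: "j \<in> {c<..?M}"
    show "S j \<in> corner_span (r - 1)" unfolding S_def
    proof (rule cfun.subspace_sum[OF subspace_corner_span])
      fix k assume k: "k \<in> col_set \<alpha> t j - {n}"
      have "transpose k n permutes {1..n}"
        using k n1 col_set_subset[OF t] by (intro permutes_swap_id) blast+
      then have tt: "tableau \<alpha> (transpose k n \<circ> t)" by (rule tableau_comp[OF t])
      have "transpose k n k \<in> col_set \<alpha> (transpose k n \<circ> t) j"
        unfolding col_set_comp using k by (intro imageI) auto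
      then have nc: "n \<in> col_set \<alpha> (transpose k n \<circ> t) j" by simp
      have "i \<le> r - 1" if i: "(i, j) \<in> D" for i
      proof -
        have "(i, c) \<in> D" using diagram_down[OF i, of i c] i j c1 by (auto simp: diagram_iff)
        then have "i \<le> r" using cd(3) by blast
        moreover have "i \<noteq> r" using i j cd(2) by (auto simp: diagram_iff)
        ultimately show ?thesis by simp
      qed
      then show "?g k \<in> corner_span (r - 1)" by (rule polytabloid_in_corner_span[OF tt nc])
    qed
  qed
  finally show ?thesis .
qed

lemma jucys_murphy_corner_span:
  assumes "v \<in> corner_span s"
  shows "jucys_murphy n v - fscale (content s) v \<in> corner_span (s - 1)"
proof -
  let ?V = "{v. jucys_murphy n v - fscale (content s) v \<in> corner_span (s - 1)}"
  interpret X: Vector_Spaces.linear fscale fscale "jucys_murphy n" by (rule lin_jucys_murphy)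
  have "corner_span s \<subseteq> ?V"
  proof (rule corner_span_minimal)
    have "lin (\<lambda>v. jucys_murphy n v - fscale (content s) v)"
      by (rule linI) (simp_all add: X.add X.scale cfun.scale_right_distrib cfun.scale_right_diff_distrib mult.commute)
    then interpret L: Vector_Spaces.linear fscale fscale "\<lambda>v. jucys_murphy n v - fscale (content s) v" .
    show "cfun.subspace ?V" using L.subspace_vimage[OF subspace_corner_span, of "s - 1"] by (simp add: vimage_def)
  next
    fix t r assume t: "tableau \<alpha> t" and r: "corner r" "r \<le> s" "t (r, nat (\<alpha> r)) = n"
    have j: "jucys_murphy n (e t) - fscale (content r) (e t) \<in> corner_span (r - 1)"
      by (rule jucys_murphy_corner_polytabloid[OF t r(1,3)])
    show "e t \<in> ?V"
    proof (cases "r = s")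
      case True
      then show ?thesis using j by simp
    next
      case False
      then have "e t \<in> corner_span (s - 1)" using r by (intro corner_span_base[OF t r(1)]) auto
      moreover have "jucys_murphy n (e t) - fscale (content r) (e t) \<in> corner_span (s - 1)"
        using j r(2) corner_span_mono[OF diff_le_mono, of r s 1] by blast
      ultimately have "(jucys_murphy n (e t) - fscale (content r) (e t)) + fscale (content r - content s) (e t) \<in> corner_span (s - 1)"
        by (intro cfun.subspace_add cfun.subspace_scale subspace_corner_span)
      then show ?thesis by (simp add: cfun.scale_left_diff_distrib)
    qed
  qed
  then show ?thesis using assms by blast
qed

lemma jucys_murphy_corner_span_stable:
  assumes "v \<in> corner_span s" shows "jucys_murphy n v \<in> corner_span s"
proof -
  have "jucys_murphy n v - fscale (content s) v \<in> corner_span s"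
    using jucys_murphy_corner_span[OF assms] corner_span_mono[of "s - 1" s] by auto
  then have "(jucys_murphy n v - fscale (content s) v) + fscale (content s) v \<in> corner_span s"
    using assms by (intro cfun.subspace_add cfun.subspace_scale subspace_corner_span)
  then show ?thesis by simp
qed

section \<open>Coincidence of the two filtrations\<close>

lemma content_distinct:
  assumes "1 \<le> i" "i < j" shows "content i \<noteq> content j"
  using alpha_antimono[of i j] assms unfolding content_def of_int_eq_iff by simp

text \<open>
  On \<open>row_filtration j\<close> the operator \<open>X\<close> is triangular with the contents of rows up to \<open>j\<close> as
  eigenvalues. So if \<open>d\<close> is none of them, \<open>X - d\<close> is invertible there, and \<open>v\<close> can be recovered from
  \<open>(X - d) v\<close> inside any space that is stable under \<open>X\<close>.
\<close>

lemma eigenvector_mod_corner_span: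
  assumes n: "n > 0" and "v \<in> row_filtration j" "\<And>i. 1 \<le> i \<Longrightarrow> i \<le> j \<Longrightarrow> content i \<noteq> d"
    and "jucys_murphy n v - fscale d v \<in> corner_span s"
  shows "v \<in> corner_span s"
  using assms(2-4)
proof (induction j arbitrary: v)
  case 0
  then have "v = 0" using row_filtration_0[OF n] by blast
  then show ?case using cfun.subspace_0[OF subspace_corner_span] by metis
next
  case (Suc j)
  interpret X: Vector_Spaces.linear fscale fscale "jucys_murphy n" by (rule lin_jucys_murphy)
  \<comment> \<open>The operators \<open>X - c\<close> and \<open>X - d\<close> commute, so the induction hypothesis applies to \<open>(X - c) v\<close>.
    Subtracting this from \<open>(X - d) v\<close> leaves a nonzero multiple of \<open>v\<close>.\<close>
  let ?c = "content (Suc j)"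
  let ?w = "jucys_murphy n v - fscale ?c v" and ?u = "jucys_murphy n v - fscale d v"
  have "jucys_murphy n ?w - fscale d ?w = jucys_murphy n ?u - fscale ?c ?u"
    by (simp add: X.diff X.scale cfun.scale_right_diff_distrib mult.commute)
  also have "\<dots> \<in> corner_span s"
    by (rule cfun.subspace_diff[OF subspace_corner_span jucys_murphy_corner_span_stable[OF Suc.prems(3)]
          cfun.subspace_scale[OF subspace_corner_span Suc.prems(3)]])
  finally have "jucys_murphy n ?w - fscale d ?w \<in> corner_span s" .
  moreover have "?w \<in> row_filtration j" using jucys_murphy_row_filtration[OF Suc.prems(1)] by simp
  ultimately have "?w \<in> corner_span s" using Suc.IH Suc.prems(2) by (metis le_SucI)
  with Suc.prems(3) have "?u - ?w \<in> corner_span s" by (rule cfun.subspace_diff[OF subspace_corner_span])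
  moreover have "?u - ?w = fscale (?c - d) v" by (simp add: cfun.scale_left_diff_distrib)
  ultimately have "fscale (inverse (?c - d)) (fscale (?c - d) v) \<in> corner_span s"
    by (metis cfun.subspace_scale subspace_corner_span)
  then show ?case using Suc.prems(2)[of "Suc j"] by simp
qed

text \<open>
  Descending from \<open>s = len \<alpha>\<close>, where both spaces are \<open>S\<^sup>\<alpha>\<close>: a vector \<open>v\<close> of \<open>row_filtration s\<close> lies in
  \<open>corner_span (s + 1)\<close> by induction, so \<open>X - d\<close> for the content \<open>d\<close> of row \<open>s + 1\<close> maps it to
  \<open>corner_span s\<close>. As \<open>d\<close> differs from the contents of the rows up to \<open>s\<close>, \<open>v\<close> itself is in \<open>corner_span s\<close>.
\<close>

lemma row_filtration_eq_corner_span: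
  assumes n: "n > 0" and "s \<le> len \<alpha>"
  shows "row_filtration s = corner_span s"
  using assms(2)
proof (induction rule: inc_induct)
  case base
  then show ?case using row_filtration_len specht_eq_corner_span[OF n] by simp
next
  case (step s)
  have "v \<in> corner_span s" if v: "v \<in> row_filtration s" for v
  proof (rule eigenvector_mod_corner_span[OF n v])
    have "v \<in> corner_span (Suc s)" using v row_filtration_mono[of s "Suc s"] step.IH by auto
    then show "jucys_murphy n v - fscale (content (Suc s)) v \<in> corner_span s"
      using jucys_murphy_corner_span[of v "Suc s"] by simp
  qed (use content_distinct in auto)
  then show ?case using corner_span_subset_row_filtration by blast
qed

lemma corner_span_not_corner: "\<not> corner s \<Longrightarrow> 1 \<le> s \<Longrightarrow> corner_span s = corner_span (s - 1)"
proof -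
  assume "\<not> corner s" "1 \<le> s"
  then have "corner r \<and> r \<le> s \<longleftrightarrow> corner r \<and> r \<le> s - 1" for r by (cases "r = s") auto
  then show ?thesis unfolding corner_span_def by (metis (mono_tags, lifting))
qed

end

section \<open>Removing the largest entry\<close>

text \<open>
  The dual form of deleting \<open>n\<close> from row \<open>s\<close> of a tabloid and of killing the tabloids with \<open>n\<close> in a
  different row: the value at \<open>T\<close> is read off at \<open>T\<close> with \<open>n\<close> put back. The case distinction makes the
  result vanish at sequences that still contain \<open>n\<close> in row \<open>s\<close>.
\<close>

definition remove_point :: "nat \<Rightarrow> nat \<Rightarrow> ((nat \<Rightarrow> nat set) \<Rightarrow> complex) \<Rightarrow> (nat \<Rightarrow> nat set) \<Rightarrow> complex" where
  "remove_point n s v = (\<lambda>T. if n \<in> T s then 0 else v (T(s := insert n (T s))))"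

lemma lin_remove_point: "lin (remove_point n s)"
  by (rule linI) (simp_all add: remove_point_def fscale_def fun_eq_iff)

lemma remove_point_perm_action:
  assumes "\<tau> permutes {1..n}" "\<tau> n = n"
  shows "remove_point n s (perm_action \<tau> v) = perm_action \<tau> (remove_point n s v)"
proof
  fix T
  have i: "inv \<tau> n = n" using assms by (metis permutes_inverses(2))
  have "(\<lambda>i. inv \<tau> ` (T(s := insert n (T s))) i) = (\<lambda>i. inv \<tau> ` T i)(s := insert n (inv \<tau> ` T s))"
    using i by (auto simp: fun_eq_iff)
  moreover have "n \<in> inv \<tau> ` T s \<longleftrightarrow> n \<in> T s"
    using inj_image_mem_iff[OF permutes_inj[OF permutes_inv[OF assms(1)]], of n "T s"] i by simp
  ultimately show "remove_point n s (perm_action \<tau> v) T = perm_action \<tau> (remove_point n s v) T"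
    by (simp add: remove_point_def perm_action_def)
qed

context partition_shape
begin

lemma remove_point_kernel:
  assumes "1 \<le> s"
  shows "row_filtration (s - 1) = {v \<in> row_filtration s. remove_point n s v = 0}"
proof
  show "row_filtration (s - 1) \<subseteq> {v \<in> row_filtration s. remove_point n s v = 0}"
  proof
    fix v assume v: "v \<in> row_filtration (s - 1)"
    have "remove_point n s v T = 0" for T
      using row_filtration_vanishes[OF v, of s "T(s := insert n (T s))"] assms by (simp add: remove_point_def)
    then show "v \<in> {v \<in> row_filtration s. remove_point n s v = 0}" using v row_filtration_mono[of "s - 1" s] by auto
  qed
  show "{v \<in> row_filtration s. remove_point n s v = 0} \<subseteq> row_filtration (s - 1)"
  proof
    fix v assume "v \<in> {v \<in> row_filtration s. remove_point n s v = 0}"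
    then have v: "v \<in> row_filtration s" and z: "remove_point n s v = 0" by auto
    have "v T = 0" if "s - 1 < i" "n \<in> T i" for T i
    proof (cases "i = s")
      case True
      have "remove_point n s v (T(s := T s - {n})) = 0" using z by (simp add: fun_eq_iff)
      then show ?thesis using that True by (simp add: remove_point_def insert_absorb)
    next
      case False
      then show ?thesis using row_filtration_vanishes[OF v, of i T] that by simp
    qed
    then show "v \<in> row_filtration (s - 1)" using v by (simp add: row_filtration_def)
  qed
qed

lemma corner_le_len: "corner s \<Longrightarrow> s \<le> len \<alpha>"
  using diagram_row_le[OF corner_diagram(1)] .

lemma sum_alpha: "len \<alpha> \<le> L \<Longrightarrow> (\<Sum>i = 1..L. \<alpha> i) = int n"
proof -
  assume L: "len \<alpha> \<le> L"
  have "(\<Sum>i = 1..L. \<alpha> i) = (\<Sum>i = 1..len \<alpha>. \<alpha> i)"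
    using L Gam_uptoD[OF Gam_alpha] by (intro sum.mono_neutral_right) auto
  then show ?thesis using part by (simp add: partition_of_def weight_def)
qed

lemma partition_remove_corner:
  assumes s: "corner s"
  shows "partition_of (\<alpha> - eps s) (n - 1)" "n > 0"
proof -
  let ?a = "\<alpha> - eps s"
  have sl: "1 \<le> s" "s \<le> len \<alpha>" using s corner_le_len by (auto simp: corner_def)
  have pos: "\<alpha> s > 0" using s alpha_nonneg[of "s + 1"] by (simp add: corner_def)
  have U: "?a \<in> Gam_upto (len \<alpha>)" using Gam_alpha sl by (auto simp: Gam_upto_def eps_def)
  then have U': "?a \<in> Gam" by (rule Gam_uptoI_Gam)
  have "weight ?a = (\<Sum>i = 1..len \<alpha>. ?a i)"
    unfolding weight_def using len_le[OF U] Gam_uptoD[OF Gam_upto_len[OF U']]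
    by (intro sum.mono_neutral_left) auto
  also have "\<dots> = (\<Sum>i = 1..len \<alpha>. \<alpha> i) - (\<Sum>i = 1..len \<alpha>. if i = s then 1 else 0)"
    by (simp add: eps_def sum_subtractf)
  also have "\<dots> = int n - 1" using sl sum_alpha[of "len \<alpha>"] by simp
  finally have w: "weight ?a = int n - 1" .
  have nn: "?a i \<ge> 0" for i using alpha_nonneg[of i] pos by (auto simp: eps_def)
  have "weight ?a \<ge> 0" unfolding weight_def by (rule sum_nonneg) (rule nn)
  with w show n: "n > 0" by simp
  have "?a (i + 1) \<le> ?a i" if "1 \<le> i" for i
    using alpha_antimono[of i "i + 1"] that s by (auto simp: eps_def corner_def)
  then show "partition_of ?a (n - 1)"
    using U' nn w n by (simp add: partition_of_def Gam_nonneg_def)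
qed

text \<open>
  Only the column permutations that leave \<open>n\<close> in row \<open>s\<close> survive. Since \<open>n\<close> stays in its column, it is
  then back in its own cell. So these permutations fix \<open>n\<close>, and they form the column stabilizer for
  \<open>\<alpha> - eps s\<close>.
\<close>

lemma remove_point_polytabloid:
  assumes t: "tableau \<alpha> t" and s: "corner s" and tn: "t (s, nat (\<alpha> s)) = n"
  shows "tableau (\<alpha> - eps s) t" "remove_point n s (e t) = polytabloid (\<alpha> - eps s) t"
proof -
  let ?a = "\<alpha> - eps s"
  define c where "c = nat (\<alpha> s)"
  note cd = corner_diagram[OF s, folded c_def]
  interpret b: partition_shape ?a "n - 1" by unfold_locales (rule partition_remove_corner[OF s])
  have n0: "n > 0" by (rule partition_remove_corner[OF s])
  have D': "diagram ?a = D - {(s, c)}"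
    using cd(2) by (auto simp: diagram_def eps_def split: if_splits)
  have tn': "t (s, c) = n" using tn by (simp add: c_def)
  have iv: "{1..n} - {n} = {1..n - 1}" using n0 by auto
  have "bij_betw t (D - {(s, c)}) ({1..n} - {n})"
    using t cd(1) tn' n0 by (intro bij_betw_DiffI) (simp_all add: tableau_iff)
  then show t': "tableau ?a t" unfolding b.tableau_iff D' iv .
  have col': "col_set ?a t j = col_set \<alpha> t j - {n}" for j
  proof -
    have "t (i, j) = n \<longleftrightarrow> (i, j) = (s, c)" if "(i, j) \<in> D" for i j
      using tableau_inj[OF t that cd(1)] tn' by simp
    then show ?thesis by (auto simp: col_set_def D')
  qed
  have row': "row_set ?a (\<pi> \<circ> t) = (row_set \<alpha> (\<pi> \<circ> t))(s := row_set \<alpha> (\<pi> \<circ> t) s - {n})"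
    and row_n: "n \<in> row_set \<alpha> (\<pi> \<circ> t) s"
    if p: "\<pi> \<in> C t" and pn: "\<pi> n = n" for \<pi>
  proof -
    have pt: "tableau \<alpha> (\<pi> \<circ> t)" by (rule tableau_comp[OF t column_stabilizer_permutes[OF p]])
    have *: "(\<pi> \<circ> t) (i, j) = n \<longleftrightarrow> (i, j) = (s, c)" if "(i, j) \<in> D" for i j
      using tableau_inj[OF pt that cd(1)] tn' pn by simp
    show "row_set ?a (\<pi> \<circ> t) = (row_set \<alpha> (\<pi> \<circ> t))(s := row_set \<alpha> (\<pi> \<circ> t) s - {n})"
    proof
      fix i
      show "row_set ?a (\<pi> \<circ> t) i = ((row_set \<alpha> (\<pi> \<circ> t))(s := row_set \<alpha> (\<pi> \<circ> t) s - {n})) i"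
        using * by (cases "i = s") (auto simp: row_set_def D')
    qed
    show "n \<in> row_set \<alpha> (\<pi> \<circ> t) s"
      unfolding row_set_def using cd(1) *[OF cd(1)] by blast
  qed
  have C': "column_stabilizer ?a t = {\<pi> \<in> C t. \<pi> n = n}"
  proof -
    have perm: "\<pi> permutes {1..n - 1} \<longleftrightarrow> \<pi> permutes {1..n} \<and> \<pi> n = n" for \<pi>
    proof
      assume p: "\<pi> permutes {1..n - 1}"
      then show "\<pi> permutes {1..n} \<and> \<pi> n = n"
        using permutes_subset[OF p, of "{1..n}"] permutes_not_in[OF p, of n] n0 by auto
    next
      assume p: "\<pi> permutes {1..n} \<and> \<pi> n = n"
      show "\<pi> permutes {1..n - 1}"
      proof (rule permutes_superset[OF conjunct1[OF p]])
        fix x assume "x \<in> {1..n} - {1..n - 1}"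
        then have "x = n" by auto
        then show "\<pi> x = x" using p by simp
      qed
    qed
    have img: "\<pi> ` (X - {n}) = X - {n} \<longleftrightarrow> \<pi> ` X = X" if "\<pi> permutes {1..n}" "\<pi> n = n" for \<pi> X
    proof -
      have "\<pi> ` (X - {n}) = \<pi> ` X - {n}"
        using that image_set_diff[OF permutes_inj[OF that(1)], of X "{n}"] by simp
      moreover have "n \<in> \<pi> ` X \<longleftrightarrow> n \<in> X"
        using inj_image_mem_iff[OF permutes_inj[OF that(1)], of n X] that(2) by simp
      moreover have "A - {n} = B - {n} \<longleftrightarrow> A = B" if "n \<in> A \<longleftrightarrow> n \<in> B" for A B
        using that by blast
      ultimately show ?thesis by (simp only:)
    qed
    have "\<pi> \<in> column_stabilizer ?a t \<longleftrightarrow> \<pi> \<in> C t \<and> \<pi> n = n" for \<pi>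
      unfolding b.column_stabilizer_iff column_stabilizer_iff col' perm
      using img[of \<pi>] by meson
    then show ?thesis by blast
  qed
  show "remove_point n s (e t) = polytabloid ?a t"
  proof
    fix T
    show "remove_point n s (e t) T = polytabloid ?a t T"
    proof (cases "n \<in> T s")
      case True
      have "T \<noteq> row_set ?a (\<pi> \<circ> t)" if "\<pi> \<in> column_stabilizer ?a t" for \<pi>
        using row'[of \<pi>] that True unfolding C' by auto
      then have "polytabloid ?a t T = 0"
        by (auto simp: b.polytabloid_apply intro!: sum.neutral)
      then show ?thesis using True by (simp add: remove_point_def)
    next
      case False
      let ?T = "T(s := insert n (T s))"
      have fix_n: "\<pi> n = n" if p: "\<pi> \<in> C t" and eq: "?T = row_set \<alpha> (\<pi> \<circ> t)" for \<pi>
      proof -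
        have "n \<in> row_set \<alpha> (\<pi> \<circ> t) s" unfolding eq[symmetric] by simp
        then obtain j where j: "(s, j) \<in> D" "n = \<pi> (t (s, j))" by (auto simp: row_set_def)
        have "j = c" using stabilizer_column[OF t p j(1) cd(1)] j(2) tn' by simp
        then show ?thesis using j tn' by simp
      qed
      have eq_iff: "?T = row_set \<alpha> (\<pi> \<circ> t) \<longleftrightarrow> T = row_set ?a (\<pi> \<circ> t)"
        if "\<pi> \<in> C t" "\<pi> n = n" for \<pi>
        using False row_n[OF that] unfolding row'[OF that] by (auto simp: fun_eq_iff)
      have "remove_point n s (e t) T = (\<Sum>\<pi>\<in>C t. if ?T = row_set \<alpha> (\<pi> \<circ> t) then of_int (sign \<pi>) else 0)"
        using False by (simp add: remove_point_def polytabloid_apply)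
      also have "\<dots> = (\<Sum>\<pi>\<in>column_stabilizer ?a t. if T = row_set ?a (\<pi> \<circ> t) then of_int (sign \<pi>) else 0)"
      proof (rule sum.mono_neutral_cong_right[OF finite_column_stabilizer])
        show "column_stabilizer ?a t \<subseteq> C t" unfolding C' by blast
        show "\<forall>\<pi>\<in>C t - column_stabilizer ?a t. (if ?T = row_set \<alpha> (\<pi> \<circ> t) then of_int (sign \<pi>) else 0) = 0"
          unfolding C' using fix_n by auto
        show "(if ?T = row_set \<alpha> (\<pi> \<circ> t) then of_int (sign \<pi>) else 0)
            = (if T = row_set ?a (\<pi> \<circ> t) then of_int (sign \<pi>) else 0)"
          if "\<pi> \<in> column_stabilizer ?a t" for \<pi>
          using that eq_iff[of \<pi>] unfolding C' by simp
      qed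
      also have "\<dots> = polytabloid ?a t T" by (simp add: b.polytabloid_apply)
      finally show ?thesis .
    qed
  qed
qed

text \<open>
  Polytabloids with \<open>n\<close> in a corner of a higher row are in the kernel, and every tableau of shape
  \<open>\<alpha> - eps s\<close> extends to one of shape \<open>\<alpha>\<close> with \<open>n\<close> in the corner of row \<open>s\<close>.
\<close>

lemma remove_point_image:
  assumes s: "corner s"
  shows "remove_point n s ` corner_span s = specht (\<alpha> - eps s)"
proof
  let ?a = "\<alpha> - eps s"
  interpret b: partition_shape ?a "n - 1" by unfold_locales (rule partition_remove_corner[OF s])
  interpret l: Vector_Spaces.linear fscale fscale "remove_point n s" by (rule lin_remove_point)
  have n0: "n > 0" by (rule partition_remove_corner[OF s])
  have s1: "1 \<le> s" using s by (simp add: corner_def)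
  have "corner_span s \<subseteq> remove_point n s -` specht ?a"
  proof (rule corner_span_minimal)
    show "cfun.subspace (remove_point n s -` specht ?a)"
      by (rule l.subspace_vimage[OF b.subspace_specht])
    fix t r assume t: "tableau \<alpha> t" and r: "corner r" "r \<le> s" "t (r, nat (\<alpha> r)) = n"
    show "e t \<in> remove_point n s -` specht ?a"
    proof (cases "r = s")
      case True
      then show ?thesis
        using remove_point_polytabloid[OF t s] r b.polytabloid_in_specht by simp
    next
      case False
      then have "r \<le> s - 1" using r(2) by simp
      then have "e t \<in> row_filtration (s - 1)" using corner_span_base[OF t r(1) _ r(3)] corner_span_subset_row_filtration by blast
      then show ?thesis
        using remove_point_kernel[OF s1] cfun.subspace_0[OF b.subspace_specht] by auto
    qed
  qed
  then show "remove_point n s ` corner_span s \<subseteq> specht ?a" by blast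
  show "specht ?a \<subseteq> remove_point n s ` corner_span s"
  proof (rule b.specht_minimal)
    show "cfun.subspace (remove_point n s ` corner_span s)" by (rule l.subspace_image[OF subspace_corner_span])
    fix t' assume t': "tableau ?a t'"
    define c where "c = nat (\<alpha> s)"
    note cd = corner_diagram[OF s, folded c_def]
    define t where "t = t'((s, c) := n)"
    have D': "diagram ?a = D - {(s, c)}"
      using cd(2) by (auto simp: diagram_def eps_def split: if_splits)
    have "bij_betw t' (D - {(s, c)}) {1..n - 1}" using t' unfolding b.tableau_iff D' .
    then have "bij_betw t (D - {(s, c)}) {1..n - 1}"
      by (rule bij_betw_cong[THEN iffD1, rotated]) (auto simp: t_def)
    then have "bij_betw t (D - {(s, c)} \<union> {(s, c)}) ({1..n - 1} \<union> {n})"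
      using n0 by (intro bij_betw_combine) (auto simp: t_def bij_betw_def)
    moreover have "D - {(s, c)} \<union> {(s, c)} = D" "{1..n - 1} \<union> {n} = {1..n}" using cd(1) n0 by auto
    ultimately have t: "tableau \<alpha> t" by (simp add: tableau_iff)
    have tn: "t (s, nat (\<alpha> s)) = n" by (simp add: t_def c_def)
    have agree: "t' x = t x" if "x \<in> diagram ?a" for x using that unfolding D' by (auto simp: t_def)
    have rows: "row_set ?a (\<pi> \<circ> t') = row_set ?a (\<pi> \<circ> t)" for \<pi>
    proof
      fix i
      have "{(\<pi> \<circ> t') (i, j) |j. (i, j) \<in> diagram ?a} = {(\<pi> \<circ> t) (i, j) |j. (i, j) \<in> diagram ?a}"
        using agree by (metis (no_types, lifting) comp_apply)
      then show "row_set ?a (\<pi> \<circ> t') i = row_set ?a (\<pi> \<circ> t) i" by (simp only: row_set_def)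
    qed
    have cols: "col_set ?a t' = col_set ?a t"
    proof
      fix j
      have "{t' (i, j) |i. (i, j) \<in> diagram ?a} = {t (i, j) |i. (i, j) \<in> diagram ?a}"
        using agree by (metis (no_types, lifting))
      then show "col_set ?a t' j = col_set ?a t j" by (simp only: col_set_def)
    qed
    have "polytabloid ?a t' = polytabloid ?a t"
      unfolding polytabloid_def column_stabilizer_def rows cols ..
    also have "\<dots> = remove_point n s (e t)" using remove_point_polytabloid[OF t s tn] by simp
    finally show "polytabloid ?a t' \<in> remove_point n s ` corner_span s"
      using corner_span_base[OF t s order_refl tn] by blast
  qed
qed

section \<open>Branching rule and Jucys-Murphy traces\<close>

lemma finite_corners: "finite {r. corner r}"
  by (rule finite_subset[of _ "{..len \<alpha>}"]) (use corner_le_len in auto)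

lemma row_filtration_finite_dimensional: "row_filtration s \<subseteq> cfun.span (tabloid_vec ` {T. is_tabloid T})"
  using row_filtration_specht specht_finite_dimensional by blast

lemma finite_tabloid_vecs: "finite (tabloid_vec ` {T. is_tabloid T})"
  using finite_tabloids by simp

text \<open>
  Each step of the filtration is an exact sequence given by \<open>remove_point\<close>, or is trivial if row \<open>s\<close>
  has no corner. The scalars \<open>d\<close> are 1 for \<open>f = \<tau>\<close> and the contents for \<open>f = \<tau> X\<close>.
\<close>

lemma trace_on_row_filtration:
  assumes n: "n > 0" and \<tau>: "\<tau> permutes {1..n - 1}"
    and f: "lin f" "\<And>s. f ` row_filtration s \<subseteq> row_filtration s"
    and comm: "\<And>s v. corner s \<Longrightarrow> v \<in> row_filtration s \<Longrightarrow>
      remove_point n s (f v) = fscale (d s) (perm_action \<tau> (remove_point n s v))"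
    and s: "s \<le> len \<alpha>"
  shows "trace_on (row_filtration s) f = (\<Sum>r | corner r \<and> r \<le> s. d r * specht_character (\<alpha> - eps r) \<tau>)"
  using s
proof (induction s)
  case 0
  have "{r. corner r \<and> r \<le> 0} = {}" by (auto simp: corner_def)
  then show ?case using row_filtration_0[OF n] by (simp only: trace_on_zero_space sum.empty)
next
  case (Suc s)
  have IH: "trace_on (row_filtration s) f = (\<Sum>r | corner r \<and> r \<le> s. d r * specht_character (\<alpha> - eps r) \<tau>)"
    by (rule Suc.IH) (use Suc.prems in simp)
  show ?case
  proof (cases "corner (Suc s)")
    case False
    then have "row_filtration (Suc s) = row_filtration s"
      using corner_span_not_corner[of "Suc s"] row_filtration_eq_corner_span[OF n, of s] row_filtration_eq_corner_span[OF n, of "Suc s"] Suc.prems by simp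
    moreover have "{r. corner r \<and> r \<le> Suc s} = {r. corner r \<and> r \<le> s}"
      using False by (auto simp: le_Suc_eq)
    ultimately show ?thesis using IH by (simp only:)
  next
    case True
    let ?a = "\<alpha> - eps (Suc s)"
    interpret b: partition_shape ?a "n - 1" by unfold_locales (rule partition_remove_corner[OF True])
    interpret p: Vector_Spaces.linear fscale fscale "perm_action \<tau>" by (rule lin_perm_action)
    have "trace_on (row_filtration (Suc s)) f = trace_on (row_filtration s) f
        + trace_on (specht ?a) (\<lambda>w. fscale (d (Suc s)) (perm_action \<tau> w))"
    proof (rule trace_on_exact_sequence[where \<theta> = "remove_point n (Suc s)",
            OF subspace_row_filtration finite_tabloid_vecs row_filtration_finite_dimensional f(1) f(2) _ lin_remove_point])
      show "lin (\<lambda>w. fscale (d (Suc s)) (perm_action \<tau> w))"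
        by (rule linI) (simp_all add: p.add p.scale cfun.scale_right_distrib mult.commute)
      show "remove_point n (Suc s) ` row_filtration (Suc s) = specht ?a"
        using remove_point_image[OF True] row_filtration_eq_corner_span[OF n Suc.prems] by simp
      show "row_filtration s = {v \<in> row_filtration (Suc s). remove_point n (Suc s) v = 0}"
        using remove_point_kernel[of "Suc s"] by simp
    qed (rule comm[OF True])
    also have "trace_on (specht ?a) (\<lambda>w. fscale (d (Suc s)) (perm_action \<tau> w))
        = d (Suc s) * specht_character ?a \<tau>"
      unfolding specht_character_def
      by (rule trace_on_scale[OF b.subspace_specht b.finite_tabloid_vecs b.specht_finite_dimensional lin_perm_action])
         (use b.perm_action_specht[OF \<tau>] in blast)
    also have "trace_on (row_filtration s) f + d (Suc s) * specht_character ?a \<tau>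
       = (\<Sum>r\<in>insert (Suc s) {r. corner r \<and> r \<le> s}. d r * specht_character (\<alpha> - eps r) \<tau>)"
      unfolding IH by (subst sum.insert) (use finite_subset[OF _ finite_corners] in auto)
    also have "insert (Suc s) {r. corner r \<and> r \<le> s} = {r. corner r \<and> r \<le> Suc s}"
      using True by (auto simp: le_Suc_eq)
    finally show ?thesis .
  qed
qed

lemma trace_on_specht:
  assumes n: "n > 0" and \<tau>: "\<tau> permutes {1..n - 1}"
    and f: "lin f" "\<And>s. f ` row_filtration s \<subseteq> row_filtration s"
    and comm: "\<And>s v. corner s \<Longrightarrow> v \<in> row_filtration s \<Longrightarrow>
      remove_point n s (f v) = fscale (d s) (perm_action \<tau> (remove_point n s v))"
  shows "trace_on (specht \<alpha>) f = (\<Sum>r | corner r. d r * specht_character (\<alpha> - eps r) \<tau>)"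
proof -
  have "{r. corner r \<and> r \<le> len \<alpha>} = {r. corner r}" using corner_le_len by blast
  then show ?thesis using trace_on_row_filtration[OF assms order_refl] row_filtration_len by simp
qed

lemma permutes_pred_imp:
  assumes "n > 0" "\<tau> permutes {1..n - 1}"
  shows "\<tau> permutes {1..n}" "\<tau> n = n"
  using permutes_subset[OF assms(2), of "{1..n}"] permutes_not_in[OF assms(2), of n] assms(1) by auto

lemma perm_action_row_filtration:
  assumes "n > 0" and \<tau>: "\<tau> permutes {1..n - 1}" and v: "v \<in> row_filtration s"
  shows "perm_action \<tau> v \<in> row_filtration s"
proof -
  note t = permutes_pred_imp[OF assms(1,2)]
  have i: "inv \<tau> n = n" using t by (metis permutes_inverses(2))
  have "perm_action \<tau> v T = 0" if "s < i" "n \<in> T i" for T i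
    using row_filtration_vanishes[OF v that(1), of "\<lambda>i. inv \<tau> ` T i"] that(2) i
    by (metis image_eqI perm_action_def)
  moreover have "perm_action \<tau> v \<in> specht \<alpha>"
    using perm_action_specht[OF t(1)] v row_filtration_specht by blast
  ultimately show ?thesis unfolding row_filtration_def by blast
qed

theorem branching_rule:
  assumes n: "n > 0" and \<tau>: "\<tau> permutes {1..n - 1}"
  shows "specht_character \<alpha> \<tau> = (\<Sum>r | corner r. specht_character (\<alpha> - eps r) \<tau>)"
proof -
  have "trace_on (specht \<alpha>) (perm_action \<tau>) = (\<Sum>r | corner r. 1 * specht_character (\<alpha> - eps r) \<tau>)"
  proof (rule trace_on_specht[OF n \<tau> lin_perm_action])
    show "perm_action \<tau> ` row_filtration s \<subseteq> row_filtration s" for s using perm_action_row_filtration[OF n \<tau>] by blast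
    show "remove_point n s (perm_action \<tau> v) = fscale 1 (perm_action \<tau> (remove_point n s v))" for s v
      using remove_point_perm_action permutes_pred_imp[OF n \<tau>] by (simp only: cfun.scale_one)
  qed
  then show ?thesis by (simp add: specht_character_def)
qed

theorem jucys_murphy_trace:
  assumes n: "n > 0" and \<tau>: "\<tau> permutes {1..n - 1}"
  shows "(\<Sum>k = 1..<n. specht_character \<alpha> (\<tau> \<circ> transpose k n))
       = (\<Sum>r | corner r. content r * specht_character (\<alpha> - eps r) \<tau>)"
proof -
  interpret p: Vector_Spaces.linear fscale fscale "perm_action \<tau>" by (rule lin_perm_action)
  interpret X: Vector_Spaces.linear fscale fscale "jucys_murphy n" by (rule lin_jucys_murphy)
  note t = permutes_pred_imp[OF n \<tau>]
  let ?f = "\<lambda>v. perm_action \<tau> (jucys_murphy n v)"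
  have JF: "jucys_murphy n v \<in> row_filtration s" if "v \<in> row_filtration s" for v s
  proof (cases "s = 0")
    case True
    then show ?thesis using that row_filtration_0[OF n] X.zero by auto
  next
    case False
    then show ?thesis using jucys_murphy_row_filtration_stable[OF that] by simp
  qed
  have "(\<Sum>k = 1..<n. specht_character \<alpha> (\<tau> \<circ> transpose k n))
      = trace_on (specht \<alpha>) (\<lambda>v. \<Sum>k = 1..<n. perm_action (\<tau> \<circ> transpose k n) v)"
    unfolding specht_character_def
  proof (rule trace_on_sum[OF subspace_specht finite_tabloid_vecs specht_finite_dimensional lin_perm_action, symmetric])
    show "perm_action (\<tau> \<circ> transpose k n) ` specht \<alpha> \<subseteq> specht \<alpha>" if "k \<in> {1..<n}" for k
      using perm_action_specht[OF permutes_compose[OF transpose_permutes[OF that] t(1)]] by blast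
  qed
  also have "(\<lambda>v. \<Sum>k = 1..<n. perm_action (\<tau> \<circ> transpose k n) v) = ?f"
    unfolding jucys_murphy_def p.sum by (simp only: perm_action_compose[OF permutes_bij[OF t(1)] bij_transpose])
  also have "trace_on (specht \<alpha>) ?f = (\<Sum>r | corner r. content r * specht_character (\<alpha> - eps r) \<tau>)"
  proof (rule trace_on_specht[OF n \<tau>])
    show "lin ?f"
      by (rule linI) (simp_all only: X.add X.scale p.add p.scale)
    show "?f ` row_filtration s \<subseteq> row_filtration s" for s using JF perm_action_row_filtration[OF n \<tau>] by blast
    fix s v assume s: "corner s" and v: "v \<in> row_filtration s"
    interpret l: Vector_Spaces.linear fscale fscale "remove_point n s" by (rule lin_remove_point)
    have s1: "1 \<le> s" using s by (simp add: corner_def)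
    have "remove_point n s (jucys_murphy n v - fscale (content s) v) = 0"
      using jucys_murphy_row_filtration[OF v s1] remove_point_kernel[OF s1] by blast
    then have "remove_point n s (jucys_murphy n v) = fscale (content s) (remove_point n s v)"
      by (simp only: l.diff l.scale right_minus_eq)
    then show "remove_point n s (?f v) = fscale (content s) (perm_action \<tau> (remove_point n s v))"
      by (simp only: remove_point_perm_action[OF t] p.scale)
  qed
  finally show ?thesis .
qed

lemma specht_character_class_function:
  assumes p: "p permutes {1..n}" and s: "\<sigma> permutes {1..n}"
  shows "specht_character \<alpha> (p \<circ> \<sigma> \<circ> inv p) = specht_character \<alpha> \<sigma>"
proof -
  note bij = permutes_bij[OF p] permutes_bij[OF s] permutes_bij[OF permutes_inv[OF p]]
  have undo: "perm_action (inv p) (perm_action p v) = v" "perm_action p (perm_action (inv p) v) = v" for v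
    using perm_action_compose[OF bij(3,1)] perm_action_compose[OF bij(1,3)] permutes_inv_o[OF p]
    by (metis perm_action_id)+
  have g: "p \<circ> \<sigma> \<circ> inv p permutes {1..n}"
    by (rule permutes_compose[OF permutes_inv[OF p] permutes_compose[OF s p]])
  have "trace_on (specht \<alpha>) (perm_action \<sigma>) = trace_on (specht \<alpha>) (perm_action (p \<circ> \<sigma> \<circ> inv p))"
  proof (rule trace_on_conjugate[where h = "perm_action p",
        OF subspace_specht finite_tabloid_vecs specht_finite_dimensional lin_perm_action _ lin_perm_action lin_perm_action])
    show "perm_action \<sigma> ` specht \<alpha> \<subseteq> specht \<alpha>" using perm_action_specht[OF s] by blast
    show "perm_action p ` specht \<alpha> = specht \<alpha>"
    proof
      show "perm_action p ` specht \<alpha> \<subseteq> specht \<alpha>" using perm_action_specht[OF p] by blast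
      show "specht \<alpha> \<subseteq> perm_action p ` specht \<alpha>"
        using perm_action_specht[OF permutes_inv[OF p]] undo(2) by (metis image_eqI subsetI)
    qed
    interpret i: Vector_Spaces.linear fscale fscale "perm_action (inv p)" by (rule lin_perm_action)
    show "v = 0" if "perm_action p v = 0" for v using undo(1)[of v] that i.zero by metis
    show "perm_action p (perm_action \<sigma> v) = perm_action (p \<circ> \<sigma> \<circ> inv p) (perm_action p v)" for v
    proof -
      have "perm_action (p \<circ> \<sigma> \<circ> inv p) (perm_action p v) = perm_action (p \<circ> \<sigma>) v"
        using perm_action_compose[OF bij_comp[OF bij(2,1)] bij(3)] undo(1) by metis
      then show ?thesis using perm_action_compose[OF bij(1,2)] by metis
    qed
  qed
  then show ?thesis by (simp only: specht_character_def)
qed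

text \<open>
  Enlarging one or the other of two equal parts gives the same multiset of cycle lengths.
\<close>

lemma specht_character_cycle_perm_swap:
  assumes \<gamma>: "\<gamma> \<in> Gam_upto m" and jk: "j \<in> {1..m}" "k \<in> {1..m}" and eq: "\<gamma> j = \<gamma> k"
    and N: "n = (\<Sum>i = 1..m. nat ((\<gamma> + eps j) i))"
  shows "specht_character \<alpha> (cycle_perm (\<gamma> + eps j)) = specht_character \<alpha> (cycle_perm (\<gamma> + eps k))"
proof -
  let ?s = "transpose j k"
  let ?f = "\<lambda>i. nat ((\<gamma> + eps j) i)"
  have U: "\<gamma> + eps i \<in> Gam_upto m" if "i \<in> {1..m}" for i
    using \<gamma> that by (auto simp: Gam_upto_def eps_def)
  have sw: "(\<gamma> + eps k) i = (\<gamma> + eps j) (?s i)" for i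
  proof -
    consider "i = j" | "i = k" | "i \<noteq> j" "i \<noteq> k" by blast
    then show ?thesis using eq by cases (simp_all add: eps_def)
  qed
  have xs: "image_mset ?s (mset [1..<Suc m]) = mset [1..<Suc m]"
  proof -
    have "?s permutes {1..<Suc m}" using jk by (intro permutes_swap_id) auto
    then have "image_mset ?s (mset_set {1..<Suc m}) = mset_set {1..<Suc m}"
      by (metis image_mset_mset_set permutes_image permutes_inj_on)
    then show ?thesis by (simp del: upt_Suc)
  qed
  have "mset (map (\<lambda>i. nat ((\<gamma> + eps k) i)) [1..<Suc m]) = image_mset ?f (image_mset ?s (mset [1..<Suc m]))"
    unfolding sw by (simp add: multiset.map_comp comp_def del: upt_Suc)
  also have "\<dots> = mset (map ?f [1..<Suc m])" unfolding xs by simp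
  finally have "mset (map ?f [1..<Suc m]) = mset (map (\<lambda>i. nat ((\<gamma> + eps k) i)) [1..<Suc m])" ..
  from cycle_perm_conjugate[OF U[OF jk(1)] U[OF jk(2)] this N]
  obtain p where p: "p permutes {1..n}" "cycle_perm (\<gamma> + eps k) = p \<circ> cycle_perm (\<gamma> + eps j) \<circ> inv p" .
  have "cycle_perm (\<gamma> + eps j) permutes {1..n}"
    unfolding N by (rule cycle_perm_permutes[OF U[OF jk(1)]])
  then show ?thesis using specht_character_class_function[OF p(1)] p(2) by simp
qed

end

section \<open>The recursion for character values\<close>

text \<open>
  The values of a nonincreasing sequence form runs of equal values; the set on the right contains the
  starting index of each run.
\<close>

lemma sum_over_run_starts:
  fixes b :: "nat \<Rightarrow> int" and h :: "nat \<Rightarrow> complex"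
  assumes anti: "\<And>i j. 1 \<le> i \<Longrightarrow> i \<le> j \<Longrightarrow> j \<le> N \<Longrightarrow> b j \<le> b i"
    and h: "\<And>i j. i \<in> {1..N} \<Longrightarrow> j \<in> {1..N} \<Longrightarrow> b i = b j \<Longrightarrow> h i = h j"
  shows "(\<Sum>j = 1..N. h j)
    = (\<Sum>j | 1 \<le> j \<and> j \<le> N \<and> (j = 1 \<or> b j < b (j - 1)). of_nat (card {k. 1 \<le> k \<and> k \<le> N \<and> b k = b j}) * h j)"
proof -
  let ?J = "{j. 1 \<le> j \<and> j \<le> N \<and> (j = 1 \<or> b j < b (j - 1))}"
  define first where "first k = (LEAST j. 1 \<le> j \<and> b j = b k)" for k
  have f: "1 \<le> first k \<and> b (first k) = b k" "first k \<le> k" if "1 \<le> k" for k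
    using LeastI[of "\<lambda>j. 1 \<le> j \<and> b j = b k" k] Least_le[of "\<lambda>j. 1 \<le> j \<and> b j = b k" k] that
    unfolding first_def by auto
  have min: "\<not> (1 \<le> j \<and> b j = b k)" if "j < first k" for j k
    using not_less_Least that unfolding first_def by blast
  have "first ` {1..N} \<subseteq> ?J"
  proof
    fix j assume "j \<in> first ` {1..N}"
    then obtain k where k: "k \<in> {1..N}" "j = first k" by auto
    note fk = f[of k]
    have "b j < b (j - 1)" if "j \<noteq> 1"
    proof -
      have "j - 1 < first k" "1 \<le> j - 1" using that k fk by auto
      then have "b (j - 1) \<noteq> b j" using min[of "j - 1" k] k fk by auto
      moreover have "b j \<le> b (j - 1)" using \<open>1 \<le> j - 1\<close> k fk by (intro anti) auto
      ultimately show ?thesis by simp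
    qed
    then show "j \<in> ?J" using k fk by auto
  qed
  then have "(\<Sum>j = 1..N. h j) = (\<Sum>j\<in>?J. \<Sum>k | k \<in> {1..N} \<and> first k = j. h k)"
    by (intro sum.group[symmetric]) auto
  also have "\<dots> = (\<Sum>j\<in>?J. of_nat (card {k. 1 \<le> k \<and> k \<le> N \<and> b k = b j}) * h j)"
  proof (rule sum.cong[OF refl])
    fix j assume j: "j \<in> ?J"
    have fj: "first j = j"
    proof (rule ccontr)
      assume "first j \<noteq> j"
      then have lt: "first j < j" using f(2)[of j] j by auto
      have f1: "1 \<le> first j" "b (first j) = b j" using f(1)[of j] j by auto
      have "b (j - 1) \<le> b (first j)" using lt f1 j by (intro anti) auto
      then show False using j lt f1 by auto
    qed
    have "{k. k \<in> {1..N} \<and> first k = j} = {k. 1 \<le> k \<and> k \<le> N \<and> b k = b j}"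
    proof -
      have "first k = j \<longleftrightarrow> b k = b j" if "1 \<le> k" for k
      proof
        show "b k = b j" if "first k = j" using f(1)[OF \<open>1 \<le> k\<close>] that by simp
        show "first k = j" if "b k = b j" using fj that by (simp add: first_def)
      qed
      then show ?thesis by auto
    qed
    moreover have "(\<Sum>k | k \<in> {1..N} \<and> first k = j. h k) = (\<Sum>k | k \<in> {1..N} \<and> first k = j. h j)"
      using h j calculation by (intro sum.cong refl) auto
    ultimately show "(\<Sum>k | k \<in> {1..N} \<and> first k = j. h k)
        = of_nat (card {k. 1 \<le> k \<and> k \<le> N \<and> b k = b j}) * h j" by simp
  qed
  finally show ?thesis .
qed

theorem theorem5p1:
  fixes n m :: nat and \<alpha> \<beta> :: "nat \<Rightarrow> int"
  assumes "n > 0"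
    and "partition_of \<alpha> n"
    and "partition_of \<beta> n"
    and "m = len \<beta>"
  shows "(\<beta> m = 1 \<longrightarrow>
            zeta \<alpha> \<beta> =
              (\<Sum>i | 1 \<le> i \<and> i \<le> len \<alpha> \<and> \<alpha> i > \<alpha> (i + 1). zeta (\<alpha> - eps i) (\<beta> - eps m)))
       \<and> (\<beta> m \<noteq> 1 \<longrightarrow>
            zeta \<alpha> \<beta> =
              inverse (of_int (\<beta> m - 1)) *
              ((\<Sum>i | 1 \<le> i \<and> i \<le> len \<alpha> \<and> \<alpha> i > \<alpha> (i + 1).
                  of_int (\<alpha> i - int i) * zeta (\<alpha> - eps i) (\<beta> - eps m))
               - (\<Sum>j | 1 \<le> j \<and> j \<le> m - 1 \<and> (j = 1 \<or> \<beta> j < \<beta> (j - 1)).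
                  of_nat (multiplicity_in (\<beta> - eps m) j) * of_int (\<beta> j) * zeta \<alpha> (\<beta> + eps j - eps m))))"
proof -
  interpret A: partition_shape \<alpha> n by unfold_locales (rule assms)
  interpret B: partition_shape \<beta> n by unfold_locales (rule assms)
  define \<gamma> where "\<gamma> = \<beta> - eps m"
  define \<tau> where "\<tau> = cycle_perm \<gamma>"
  have \<beta>U: "\<beta> \<in> Gam_upto m" using B.Gam_alpha assms(4) by simp
  have m1: "1 \<le> m"
  proof (rule ccontr)
    assume "\<not> 1 \<le> m"
    then have "weight \<beta> = 0" using assms(4) by (simp add: weight_def)
    then show False using assms(1,3) by (simp add: partition_of_def)
  qed
  have \<beta>m: "\<beta> m \<ge> 1"
  proof (rule ccontr)
    assume "\<not> \<beta> m \<ge> 1"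
    then have z: "\<beta> m = 0" using B.alpha_nonneg[of m] by simp
    have "\<beta> i = 0" if "i = 0 \<or> i > m - 1" for i
      using that z Gam_uptoD[OF \<beta>U, of i] by (cases "i = m") auto
    then have "\<beta> \<in> Gam_upto (m - 1)" by (simp add: Gam_upto_def)
    then show False using len_le m1 assms(4) by fastforce
  qed
  have \<gamma>_eq: "\<gamma> i = (if i = m then \<beta> m - 1 else \<beta> i)" for i by (simp add: \<gamma>_def eps_def)
  have \<gamma>U: "\<gamma> \<in> Gam_upto m" using \<beta>U m1 by (auto simp: Gam_upto_def \<gamma>_eq)
  have \<gamma>nn: "\<gamma> i \<ge> 0" for i using B.alpha_nonneg[of i] \<beta>m by (simp add: \<gamma>_eq)
  have sum_\<gamma>: "n = Suc (\<Sum>k = 1..m. nat (\<gamma> k))"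
  proof -
    have "int (\<Sum>k = 1..m. nat (\<gamma> k)) = (\<Sum>k = 1..m. \<gamma> k)" using \<gamma>nn by simp
    also have "\<dots> = (\<Sum>k = 1..m. \<beta> k) - (\<Sum>k = 1..m. if k = m then 1 else 0)"
      unfolding sum_subtractf[symmetric] by (intro sum.cong) (auto simp: \<gamma>_eq)
    also have "\<dots> = int n - 1" using B.sum_alpha[of m] assms(4) m1 by simp
    finally show ?thesis by linarith
  qed
  have \<tau>: "\<tau> permutes {1..n - 1}"
    using cycle_perm_permutes[OF \<gamma>U] sum_\<gamma> by (simp add: \<tau>_def)
  have corners: "{i. 1 \<le> i \<and> i \<le> len \<alpha> \<and> \<alpha> i > \<alpha> (i + 1)} = {r. A.corner r}"
    using A.corner_le_len by (auto simp: A.corner_def)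
  have zeta_\<gamma>: "zeta \<delta> (\<beta> - eps m) = specht_character \<delta> \<tau>" for \<delta>
    by (simp only: zeta_def \<tau>_def \<gamma>_def)
  let ?R = "\<Sum>i | 1 \<le> i \<and> i \<le> len \<alpha> \<and> \<alpha> i > \<alpha> (i + 1). of_int (\<alpha> i - int i) * zeta (\<alpha> - eps i) (\<beta> - eps m)"
  let ?S = "\<Sum>j | 1 \<le> j \<and> j \<le> m - 1 \<and> (j = 1 \<or> \<beta> j < \<beta> (j - 1)).
      of_nat (multiplicity_in (\<beta> - eps m) j) * of_int (\<beta> j) * zeta \<alpha> (\<beta> + eps j - eps m)"
  have part1: "zeta \<alpha> \<beta> = (\<Sum>i | 1 \<le> i \<and> i \<le> len \<alpha> \<and> \<alpha> i > \<alpha> (i + 1). zeta (\<alpha> - eps i) (\<beta> - eps m))"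
    if "\<beta> m = 1"
  proof -
    have "zeta \<alpha> \<beta> = specht_character \<alpha> \<tau>"
      using cycle_perm_drop_final_one[OF \<beta>U m1 that] by (simp only: zeta_def \<tau>_def \<gamma>_def)
    also have "\<dots> = (\<Sum>r | A.corner r. specht_character (\<alpha> - eps r) \<tau>)"
      by (rule A.branching_rule[OF assms(1) \<tau>])
    finally show ?thesis by (simp only: corners zeta_\<gamma>)
  qed
  have part2: "of_int (\<beta> m - 1) * zeta \<alpha> \<beta> + ?S = ?R" if \<beta>m2: "\<beta> m \<noteq> 1"
  proof -
    let ?\<chi> = "\<lambda>j. specht_character \<alpha> (cycle_perm (\<gamma> + eps j))"
    have "?R = (\<Sum>r | A.corner r. A.content r * specht_character (\<alpha> - eps r) \<tau>)"
      by (simp only: corners zeta_\<gamma> A.content_def)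
    also have "\<dots> = (\<Sum>k = 1..<n. specht_character \<alpha> (cycle_perm \<gamma> \<circ> transpose k n))"
      using A.jucys_murphy_trace[OF assms(1) \<tau>] by (simp only: \<tau>_def)
    also have "\<dots> = (\<Sum>j = 1..m. of_int (\<gamma> j) * ?\<chi> j)"
      using sum_class_function_merge_point[OF \<gamma>U \<gamma>nn sum_\<gamma>, of "specht_character \<alpha>"]
        A.specht_character_class_function by blast
    also have "{1..m} = insert m {1..m - 1}" using m1 by auto
    also have "(\<Sum>j\<in>insert m {1..m - 1}. of_int (\<gamma> j) * ?\<chi> j)
        = of_int (\<gamma> m) * ?\<chi> m + (\<Sum>j = 1..m - 1. of_int (\<gamma> j) * ?\<chi> j)"
      using m1 by (intro sum.insert) auto
    also have "\<gamma> + eps m = \<beta>" by (simp add: \<gamma>_def)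
    also have "(\<Sum>j = 1..m - 1. of_int (\<gamma> j) * ?\<chi> j) = ?S"
    proof -
      let ?h = "\<lambda>j. of_int (\<gamma> j) * ?\<chi> j"
      let ?J = "{j. 1 \<le> j \<and> j \<le> m - 1 \<and> (j = 1 \<or> \<beta> j < \<beta> (j - 1))}"
      have \<gamma>\<beta>: "\<gamma> j = \<beta> j" if "j \<in> {1..m - 1}" for j using that by (auto simp: \<gamma>_eq)
      have "(\<Sum>j = 1..m - 1. ?h j)
          = (\<Sum>j\<in>?J. of_nat (card {k. 1 \<le> k \<and> k \<le> m - 1 \<and> \<beta> k = \<beta> j}) * ?h j)"
      proof (rule sum_over_run_starts)
        show "\<beta> j \<le> \<beta> i" if "1 \<le> i" "i \<le> j" for i j using B.alpha_antimono that by blast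
        show "?h i = ?h j" if ij: "i \<in> {1..m - 1}" "j \<in> {1..m - 1}" and eq: "\<beta> i = \<beta> j" for i j
        proof -
          have ij': "i \<in> {1..m}" "j \<in> {1..m}" using ij by auto
          have g: "\<gamma> i = \<gamma> j" using \<gamma>\<beta>[OF ij(1)] \<gamma>\<beta>[OF ij(2)] eq by simp
          have "(\<Sum>k = 1..m. nat ((\<gamma> + eps i) k)) = (\<Sum>k = 1..m. nat (\<gamma> k) + (if k = i then 1 else 0))"
            using \<gamma>nn by (intro sum.cong) (auto simp: eps_def nat_add_distrib)
          also have "\<dots> = n" using ij' sum_\<gamma> by (simp add: sum.distrib)
          finally show ?thesis
            using A.specht_character_cycle_perm_swap[OF \<gamma>U ij' g] g by simp
        qed
      qed
      also have "\<dots> = ?S"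
      proof (rule sum.cong[OF refl])
        fix j assume "j \<in> ?J"
        then have j: "j \<in> {1..m - 1}" by auto
        have len\<gamma>: "len \<gamma> = m"
        proof -
          have "\<not> len \<gamma> < m"
            using Gam_uptoD[OF Gam_upto_len[OF Gam_uptoI_Gam[OF \<gamma>U]], of m] \<beta>m2 by (auto simp: \<gamma>_eq)
          then show ?thesis using len_le[OF \<gamma>U] by simp
        qed
        have "{k. 1 \<le> k \<and> k \<le> len \<gamma> \<and> \<gamma> k = \<gamma> j} = {k. 1 \<le> k \<and> k \<le> m - 1 \<and> \<beta> k = \<beta> j}"
        proof -
          \<comment> \<open>The shortened last part is smaller than all others and does not add to their multiplicity.\<close>
          have "\<beta> m \<le> \<beta> j" using B.alpha_antimono[of j m] j by auto
          then have "\<gamma> k = \<gamma> j \<longleftrightarrow> k \<noteq> m \<and> \<beta> k = \<beta> j" for k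
            using \<gamma>\<beta>[OF j] by (auto simp: \<gamma>_eq)
          moreover have "k \<le> m - 1 \<longleftrightarrow> k \<le> m \<and> k \<noteq> m" for k using m1 by linarith
          ultimately show ?thesis unfolding len\<gamma> by blast
        qed
        then have mult: "multiplicity_in (\<beta> - eps m) j = card {k. 1 \<le> k \<and> k \<le> m - 1 \<and> \<beta> k = \<beta> j}"
          by (simp only: multiplicity_in_def \<gamma>_def)
        have "\<beta> + eps j - eps m = \<gamma> + eps j" by (simp add: \<gamma>_def fun_eq_iff)
        then have z: "zeta \<alpha> (\<beta> + eps j - eps m) = ?\<chi> j" by (simp only: zeta_def)
        show "of_nat (card {k. 1 \<le> k \<and> k \<le> m - 1 \<and> \<beta> k = \<beta> j}) * ?h j
          = of_nat (multiplicity_in (\<beta> - eps m) j) * of_int (\<beta> j) * zeta \<alpha> (\<beta> + eps j - eps m)"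
          unfolding mult z \<gamma>\<beta>[OF j] by (rule mult.assoc[symmetric])
      qed
      finally show ?thesis .
    qed
    finally have "?R = of_int (\<gamma> m) * specht_character \<alpha> (cycle_perm \<beta>) + ?S" .
    moreover have "\<gamma> m = \<beta> m - 1" by (simp add: \<gamma>_eq)
    ultimately show ?thesis by (simp only: zeta_def)
  qed
  have "zeta \<alpha> \<beta> = inverse (of_int (\<beta> m - 1)) * (?R - ?S)" if "\<beta> m \<noteq> 1"
  proof -
    have nz: "(of_int (\<beta> m - 1) :: complex) \<noteq> 0" using that by (simp only: of_int_eq_0_iff)
    moreover have "?R - ?S = of_int (\<beta> m - 1) * zeta \<alpha> \<beta>"
      unfolding part2[OF that, symmetric] by (rule add_diff_cancel_right')
    ultimately show ?thesis by (simp only: mult.assoc[symmetric] left_inverse[OF nz] mult_1_left)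
  qed
  with part1 show ?thesis by blast
qed

end
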